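(* The configuration space $\mathcal Z$ of six unit cylinders touching a unit ball is not connected.
   Context: A cylinder here is an infinite right circular solid cylinder in $\mathbb R^3$; a unit cylinder has radius $1$. $\mathcal Z$ is the space of all six-tuples of unit cylinders, each touching the unit ball centered at the origin from outside (i.e. the cylinder and the ball have disjoint interiors and their boundaries touch), which do not overlap (their interiors are pairwise disjoint; the cylinders are allowed to touch each other). Topology of $\mathcal Z$: a cylinder touching the unit sphere $\mathbb S^2$ from outside has a unique generator (a line on its surface parallel to its axis) tangent to $\mathbb S^2$, and a unit cylinder is determined by this tangent line. Let $M$ be the manifold of unoriented lines tangent to $\mathbb S^2$, i.e. pairs $(x,\xi)$ with $x\in\mathbb S^2$ and $\xi$ a unit tangent vector at $x$, with $(x,\xi)\sim(x,-\xi)$. Then $\mathcal Z$ is identified with a subset of $M^6$ and carries the subspace topology; explicitly, $\mathcal Z$ is the set of $(u_1,\dots,u_6)\in M^6$ such that the Euclidean distance between the lines $u_i$ and $u_j$ is at least $1$ for all $i<j$ (two equal cylinders of radius $r$ touching $\mathbb S^2$ touch each other exactly when the distance $d$ between their tangent lines satisfies $r=d/(2-d)$). *)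

theory Defs
  imports "HOL-Analysis.Analysis"
begin

section \<open>Lines and solid cylinders\<close>

definition line :: "real^3 \<Rightarrow> real^3 \<Rightarrow> (real^3) set" where
  "line a v = range (\<lambda>t. a + t *\<^sub>R v)"

definition solid_cylinder :: "real \<Rightarrow> (real^3) set \<Rightarrow> (real^3) set" where
  "solid_cylinder r L = {p. infdist p L \<le> r}"

definition unit_cylinder :: "(real^3) set \<Rightarrow> bool" where
  "unit_cylinder C \<longleftrightarrow> (\<exists>a v. norm v = 1 \<and> C = solid_cylinder 1 (line a v))"

definition touches_unit_ball :: "(real^3) set \<Rightarrow> bool" where
  "touches_unit_ball C \<longleftrightarrow>
     interior C \<inter> interior (cball 0 1) = {} \<and> frontier C \<inter> frontier (cball 0 1) \<noteq> {}"

definition touching_cylinders :: "(real^3) set set" where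
  "touching_cylinders = {C. unit_cylinder C \<and> touches_unit_ball C}"


section \<open>The manifold of unoriented tangent lines of the unit sphere\<close>

definition unit_tangents :: "((real^3) \<times> (real^3)) set" where
  "unit_tangents = {(x, \<xi>). norm x = 1 \<and> norm \<xi> = 1 \<and> x \<bullet> \<xi> = 0}"

definition tangent_lines :: "(real^3) set set" where
  "tangent_lines = (\<lambda>(x, \<xi>). line x \<xi>) ` unit_tangents"

text \<open>Two pairs in \<^const>\<open>unit_tangents\<close> span the same line iff they are equal or differ by
  the sign of the second component (lemma \<open>line_eq_iff_unit_tangents\<close> below), so the quotient
  of the unit tangent bundle by \<open>(x, \<xi>) \<sim> (x, -\<xi>)\<close> is the quotient along the map to lines.\<close>

definition tangent_line_topology :: "(real^3) set topology" where
  "tangent_line_topology = topology (\<lambda>U. U \<subseteq> tangent_lines \<and>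
     openin (top_of_set unit_tangents) {p \<in> unit_tangents. (case p of (x, \<xi>) \<Rightarrow> line x \<xi>) \<in> U})"


section \<open>The configuration space\<close>

definition generator :: "(real^3) set \<Rightarrow> (real^3) set \<Rightarrow> bool" where
  "generator C L \<longleftrightarrow> (\<exists>a b v. norm v = 1 \<and> C = solid_cylinder 1 (line a v) \<and>
     L = line b v \<and> L \<subseteq> frontier C)"

definition tangent_generator :: "(real^3) set \<Rightarrow> (real^3) set" where
  "tangent_generator C = (THE L. generator C L \<and> L \<in> tangent_lines)"

definition configurations :: "(nat \<Rightarrow> (real^3) set) set" where
  "configurations = {c \<in> {1..6} \<rightarrow>\<^sub>E touching_cylinders.
     \<forall>i\<in>{1..6}. \<forall>j\<in>{1..6}. i \<noteq> j \<longrightarrow> interior (c i) \<inter> interior (c j) = {}}"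

text \<open>The map taking a configuration to its tuple of tangent lines is injective, so the pullback
  is the subspace topology of the sixfold power of \<^const>\<open>tangent_line_topology\<close> on its image,
  the tuples of lines at pairwise distance at least \<open>1\<close>
  (lemma \<open>homeomorphic_map_configuration_space\<close> below).\<close>

definition configuration_space :: "(nat \<Rightarrow> (real^3) set) topology" where
  "configuration_space = pullback_topology configurations
     (\<lambda>c. \<lambda>i\<in>{1..6}. tangent_generator (c i))
     (product_topology (\<lambda>_. tangent_line_topology) {1..6})"


section \<open>Well-definedness\<close>

lemma istopology_tangent_lines:
  "istopology (\<lambda>U. U \<subseteq> tangent_lines \<and>
     openin (top_of_set unit_tangents) {p \<in> unit_tangents. (case p of (x, \<xi>) \<Rightarrow> line x \<xi>) \<in> U})"
  unfolding istopology_def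
proof (intro conjI allI impI)
  fix S T assume S: "S \<subseteq> tangent_lines \<and>
     openin (top_of_set unit_tangents) {p \<in> unit_tangents. (case p of (x, \<xi>) \<Rightarrow> line x \<xi>) \<in> S}"
   and T: "T \<subseteq> tangent_lines \<and>
     openin (top_of_set unit_tangents) {p \<in> unit_tangents. (case p of (x, \<xi>) \<Rightarrow> line x \<xi>) \<in> T}"
  have eq: "{p \<in> unit_tangents. (case p of (x, \<xi>) \<Rightarrow> line x \<xi>) \<in> S \<inter> T} =
     {p \<in> unit_tangents. (case p of (x, \<xi>) \<Rightarrow> line x \<xi>) \<in> S} \<inter>
     {p \<in> unit_tangents. (case p of (x, \<xi>) \<Rightarrow> line x \<xi>) \<in> T}" by blast
  show "S \<inter> T \<subseteq> tangent_lines" using S by blast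
  show "openin (top_of_set unit_tangents)
     {p \<in> unit_tangents. (case p of (x, \<xi>) \<Rightarrow> line x \<xi>) \<in> S \<inter> T}"
    unfolding eq using S T by (intro openin_Int) auto
next
  fix K assume K: "\<forall>S\<in>K. S \<subseteq> tangent_lines \<and>
     openin (top_of_set unit_tangents) {p \<in> unit_tangents. (case p of (x, \<xi>) \<Rightarrow> line x \<xi>) \<in> S}"
  have eq: "{p \<in> unit_tangents. (case p of (x, \<xi>) \<Rightarrow> line x \<xi>) \<in> \<Union>K} =
     (\<Union>S\<in>K. {p \<in> unit_tangents. (case p of (x, \<xi>) \<Rightarrow> line x \<xi>) \<in> S})" by blast
  show "\<Union>K \<subseteq> tangent_lines" using K by blast
  show "openin (top_of_set unit_tangents)
     {p \<in> unit_tangents. (case p of (x, \<xi>) \<Rightarrow> line x \<xi>) \<in> \<Union>K}"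
    unfolding eq using K by (intro openin_Union) auto
qed

lemma openin_tangent_line_topology:
  "openin tangent_line_topology U \<longleftrightarrow> U \<subseteq> tangent_lines \<and>
     openin (top_of_set unit_tangents) {p \<in> unit_tangents. (case p of (x, \<xi>) \<Rightarrow> line x \<xi>) \<in> U}"
  unfolding tangent_line_topology_def by (simp add: topology_inverse'[OF istopology_tangent_lines])

lemma topspace_tangent_line_topology [simp]: "topspace tangent_line_topology = tangent_lines"
proof (rule antisym)
  have "{p \<in> unit_tangents. (case p of (x, \<xi>) \<Rightarrow> line x \<xi>) \<in> tangent_lines} = unit_tangents"
    unfolding tangent_lines_def by auto
  then have "openin tangent_line_topology tangent_lines"
    unfolding openin_tangent_line_topology by simp
  then show "tangent_lines \<subseteq> topspace tangent_line_topology" by (rule openin_subset)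
  have "openin tangent_line_topology (topspace tangent_line_topology)" by simp
  then show "topspace tangent_line_topology \<subseteq> tangent_lines"
    unfolding openin_tangent_line_topology by blast
qed

lemma quotient_map_tangent_lines:
  "quotient_map (top_of_set unit_tangents) tangent_line_topology (\<lambda>(x, \<xi>). line x \<xi>)"
  unfolding quotient_map_def openin_tangent_line_topology topspace_tangent_line_topology
  by (simp add: tangent_lines_def)

definition perp :: "real^3 \<Rightarrow> real^3 \<Rightarrow> real^3" where
  "perp v w = w - (w \<bullet> v) *\<^sub>R v"

lemma perp_inner: "norm v = 1 \<Longrightarrow> perp v w \<bullet> v = 0"
  by (simp add: perp_def inner_diff_left norm_eq_1)

lemma norm_perp_shift:
  assumes "norm v = 1"
  shows "(norm (w - t *\<^sub>R v))\<^sup>2 = (norm (perp v w))\<^sup>2 + (w \<bullet> v - t)\<^sup>2"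
proof -
  have v: "v \<bullet> v = 1" using assms by (simp add: norm_eq_1)
  show ?thesis unfolding perp_def power2_norm_eq_inner
    using v by (simp add: inner_diff_left inner_diff_right inner_commute[of v w] power2_eq_square algebra_simps)
qed

lemma line_nonempty [simp]: "line a v \<noteq> {}"
  by (simp add: line_def)

lemma infdist_line:
  assumes "norm v = 1"
  shows "infdist p (line a v) = norm (perp v (p - a))"
proof (rule antisym)
  have "a + ((p - a) \<bullet> v) *\<^sub>R v \<in> line a v" by (auto simp: line_def)
  then have "infdist p (line a v) \<le> dist p (a + ((p - a) \<bullet> v) *\<^sub>R v)" by (rule infdist_le)
  also have "\<dots> = norm (perp v (p - a))" by (simp add: dist_norm perp_def algebra_simps)
  finally show "infdist p (line a v) \<le> norm (perp v (p - a))" .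
  have "norm (perp v (p - a)) \<le> dist p q" if q': "q \<in> line a v" for q
  proof -
    obtain t where q: "q = a + t *\<^sub>R v" using q' by (auto simp: line_def)
    have "(norm (perp v (p - a)))\<^sup>2 \<le> (norm (p - a - t *\<^sub>R v))\<^sup>2"
      unfolding norm_perp_shift[OF assms] by simp
    then have "norm (perp v (p - a)) \<le> norm (p - a - t *\<^sub>R v)"
      by (rule power2_le_imp_le) simp
    then show ?thesis by (simp add: q dist_norm algebra_simps)
  qed
  then show "norm (perp v (p - a)) \<le> infdist p (line a v)"
    by (auto simp: infdist_def intro!: cINF_greatest)
qed

lemma perp_add: "perp v (w + u) = perp v w + perp v u"
  by (simp add: perp_def inner_add_left algebra_simps)

lemma perp_scale: "perp v (t *\<^sub>R w) = t *\<^sub>R perp v w"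
  by (simp add: perp_def algebra_simps)

lemma perp_diff: "perp v (w - u) = perp v w - perp v u"
  by (simp add: perp_def inner_diff_left algebra_simps)

lemma perp_self: "norm v = 1 \<Longrightarrow> perp v v = 0"
  by (simp add: perp_def norm_eq_1)

lemma perp_perp: "norm v = 1 \<Longrightarrow> perp v (perp v w) = perp v w"
  by (simp add: perp_def norm_eq_1 inner_diff_left)

lemma closed_solid_cylinder: "closed (solid_cylinder r L)"
  unfolding solid_cylinder_def
  by (intro closed_Collect_le continuous_intros)

lemma interior_solid_cylinder:
  assumes v: "norm v = 1"
  shows "interior (solid_cylinder 1 (line a v)) = {p. infdist p (line a v) < 1}"
proof (rule interior_unique)
  show "{p. infdist p (line a v) < 1} \<subseteq> solid_cylinder 1 (line a v)"
    by (auto simp: solid_cylinder_def)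
  show "open {p. infdist p (line a v) < 1}"
    by (intro open_Collect_less continuous_intros)
  fix T assume T: "T \<subseteq> solid_cylinder 1 (line a v)" "open T"
  show "T \<subseteq> {p. infdist p (line a v) < 1}"
  proof
    fix p assume p: "p \<in> T"
    show "p \<in> {p. infdist p (line a v) < 1}"
    proof (rule ccontr)
      assume "p \<notin> {p. infdist p (line a v) < 1}"
      then have ge: "norm (perp v (p - a)) \<ge> 1" by (simp add: infdist_line[OF v])
      obtain e where e: "e > 0" "ball p e \<subseteq> T"
        using T p open_contains_ball by blast
      define w where "w = perp v (p - a)"
      have w: "norm w > 0" unfolding w_def using ge by linarith
      define d where "d = e / (2 * norm w)"
      have d: "d > 0" using e w by (simp add: d_def)
      have "dist p (p + d *\<^sub>R w) < e"
        using e w d by (simp add: dist_norm d_def)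
      then have "p + d *\<^sub>R w \<in> solid_cylinder 1 (line a v)"
        using e T by (auto simp: subset_iff)
      then have "norm (perp v (p + d *\<^sub>R w - a)) \<le> 1"
        by (simp add: solid_cylinder_def infdist_line[OF v])
      moreover have "perp v (p + d *\<^sub>R w - a) = (1 + d) *\<^sub>R w"
      proof -
        have "p + d *\<^sub>R w - a = (p - a) + d *\<^sub>R w" by simp
        then show ?thesis
          by (simp only: perp_add perp_scale) (simp add: w_def perp_perp[OF v] algebra_simps)
      qed
      ultimately have "(1 + d) * norm w \<le> 1" using d by simp
      moreover have "(1 + d) * norm w > norm w" using d w by (simp add: algebra_simps)
      ultimately show False using ge by (simp add: w_def)
    qed
  qed
qed

lemma frontier_solid_cylinder:
  assumes v: "norm v = 1"
  shows "frontier (solid_cylinder 1 (line a v)) = {p. infdist p (line a v) = 1}"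
  unfolding frontier_def closure_closed[OF closed_solid_cylinder] interior_solid_cylinder[OF v]
  by (auto simp: solid_cylinder_def)

lemma line_shift: "line (a + t *\<^sub>R v) v = line a v"
proof -
  have "a + s *\<^sub>R v = (a + t *\<^sub>R v) + (s - t) *\<^sub>R v" for s by (simp add: algebra_simps)
  moreover have "(a + t *\<^sub>R v) + s *\<^sub>R v = a + (t + s) *\<^sub>R v" for s by (simp add: algebra_simps)
  ultimately show ?thesis unfolding line_def by (metis (no_types, lifting) rangeE rangeI subsetI subset_antisym)
qed

lemma line_uminus: "line a (- v) = line a v"
proof -
  have "range (\<lambda>t. a + t *\<^sub>R (- v)) = (\<lambda>t. a + t *\<^sub>R v) ` range uminus"
    unfolding image_image by simp
  then show ?thesis by (simp add: line_def)
qed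

lemma line_bounded_direction:
  assumes v: "norm v = 1" and v': "norm v' = 1"
    and bd: "\<And>t. norm (perp v (b + t *\<^sub>R v')) \<le> 1"
  shows "v' = v \<or> v' = - v"
proof -
  have "perp v v' = 0"
  proof (rule ccontr)
    assume nz: "perp v v' \<noteq> 0"
    define t where "t = (2 + norm (perp v b)) / norm (perp v v')"
    have "norm (t *\<^sub>R perp v v') = 2 + norm (perp v b)"
      using nz by (simp add: t_def)
    moreover have "norm (t *\<^sub>R perp v v') \<le> norm (perp v (b + t *\<^sub>R v')) + norm (perp v b)"
      unfolding perp_add perp_scale
      by (metis add_diff_cancel_left' norm_triangle_ineq4)
    ultimately show False using bd[of t] by simp
  qed
  then have eq: "v' = (v' \<bullet> v) *\<^sub>R v" by (simp add: perp_def)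
  then have "norm v' = \<bar>v' \<bullet> v\<bar>" using v by (metis norm_scaleR mult_1_right)
  then have "v' \<bullet> v = 1 \<or> v' \<bullet> v = -1" using v' by linarith
  then show ?thesis using eq by (metis scaleR_one scaleR_minus1_left)
qed

lemma line_eq_iff_unit_tangents:
  assumes "(x, \<xi>) \<in> unit_tangents" "(y, \<eta>) \<in> unit_tangents"
  shows "line x \<xi> = line y \<eta> \<longleftrightarrow> x = y \<and> (\<xi> = \<eta> \<or> \<xi> = - \<eta>)"
proof
  assume eq: "line x \<xi> = line y \<eta>"
  have x: "norm x = 1" "norm \<xi> = 1" "x \<bullet> \<xi> = 0" and y: "norm y = 1" "norm \<eta> = 1" "y \<bullet> \<eta> = 0"
    using assms by (auto simp: unit_tangents_def)
  have "x = y"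
  proof -
    have "y \<in> line x \<xi>" unfolding eq by (auto simp: line_def intro: range_eqI[of _ _ 0])
    then obtain t where t: "y = x + t *\<^sub>R \<xi>" by (auto simp: line_def)
    have "y \<bullet> y = 1 + t * t"
      using x by (simp add: t inner_add_left inner_add_right inner_commute[of \<xi> x] norm_eq_1)
    then have "t = 0" using y by (simp add: norm_eq_1)
    then show ?thesis using t by simp
  qed
  moreover have "\<xi> = \<eta> \<or> \<xi> = - \<eta>"
  proof (rule line_bounded_direction[OF y(2) x(2)])
    fix t
    have "x + t *\<^sub>R \<xi> \<in> line y \<eta>" unfolding eq[symmetric] by (auto simp: line_def)
    then obtain s where s: "x + t *\<^sub>R \<xi> = y + s *\<^sub>R \<eta>" by (auto simp: line_def)
    have "perp \<eta> y = y" using y by (simp add: perp_def)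
    then show "norm (perp \<eta> (x + t *\<^sub>R \<xi>)) \<le> 1"
      unfolding s using y by (simp add: perp_add perp_scale perp_self)
  qed
  ultimately show "x = y \<and> (\<xi> = \<eta> \<or> \<xi> = - \<eta>)" by simp
qed (auto simp: line_uminus)

lemma touching_solid_cylinder_iff:
  assumes v: "norm v = 1"
  shows "touches_unit_ball (solid_cylinder 1 (line a v)) \<longleftrightarrow> norm (perp v a) = 2"
proof -
  define n where "n = perp v a"
  have n: "perp v n = n" by (simp add: n_def perp_perp[OF v])
  have lin: "perp v (p - a) = perp v p - n" for p by (simp add: perp_diff n_def)
  have le: "norm (perp v p) \<le> norm p" for p
  proof (rule power2_le_imp_le)
    show "(norm (perp v p))\<^sup>2 \<le> (norm p)\<^sup>2"
      using norm_perp_shift[OF v, of p 0] zero_le_power2[of "p \<bullet> v - 0"]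
      unfolding scaleR_zero_left diff_zero by linarith
  qed simp
  have fr: "frontier (solid_cylinder 1 (line a v)) = {p. norm (perp v p - n) = 1}"
    and int: "interior (solid_cylinder 1 (line a v)) = {p. norm (perp v p - n) < 1}"
    by (simp_all add: frontier_solid_cylinder[OF v] interior_solid_cylinder[OF v] infdist_line[OF v] lin)
  show ?thesis unfolding n_def[symmetric]
  proof
    assume t: "touches_unit_ball (solid_cylinder 1 (line a v))"
    then obtain p where p: "norm (perp v p - n) = 1" "norm p = 1"
      by (auto simp: touches_unit_ball_def fr dist_norm)
    have "norm n \<le> norm (perp v p) + norm (perp v p - n)"
      by (metis norm_minus_commute norm_triangle_sub)
    then have "norm n \<le> 2" using p le[of p] by simp
    moreover have "\<not> norm n < 2"
    proof
      assume "norm n < 2"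
      moreover have "perp v ((1/2) *\<^sub>R n) - n = - ((1/2) *\<^sub>R n)"
      proof -
        have "perp v ((1/2) *\<^sub>R n) - n = (1/2 - 1) *\<^sub>R n"
          unfolding perp_scale n scaleR_left_diff_distrib by simp
        then show ?thesis by simp
      qed
      ultimately have "(1/2) *\<^sub>R n \<in> interior (solid_cylinder 1 (line a v)) \<inter> interior (cball 0 1)"
        unfolding int by (simp add: dist_norm)
      then show False using t by (auto simp: touches_unit_ball_def)
    qed
    ultimately show "norm n = 2" by simp
  next
    assume n2: "norm n = 2"
    have "interior (solid_cylinder 1 (line a v)) \<inter> interior (cball 0 1) = {}"
    proof -
      have False if p: "norm (perp v p - n) < 1" "norm p < 1" for p
      proof -
        have "norm n \<le> norm (perp v p) + norm (perp v p - n)"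
          by (metis norm_minus_commute norm_triangle_sub)
        then show False using p le[of p] n2 by simp
      qed
      then show ?thesis unfolding int by (auto simp: dist_norm)
    qed
    moreover have "(1/2) *\<^sub>R n \<in> frontier (solid_cylinder 1 (line a v)) \<inter> frontier (cball 0 1)"
    proof -
      have "perp v ((1/2) *\<^sub>R n) - n = (1/2 - 1) *\<^sub>R n"
        unfolding perp_scale n scaleR_left_diff_distrib by simp
      then show ?thesis unfolding fr using n2 by (simp add: dist_norm)
    qed
    ultimately show "touches_unit_ball (solid_cylinder 1 (line a v))"
      by (auto simp: touches_unit_ball_def)
  qed
qed

lemma solid_cylinder_line_scale:
  "solid_cylinder r (line (2 *\<^sub>R x) \<xi>) = solid_cylinder r ((*\<^sub>R) 2 ` line x \<xi>)"
proof -
  have "2 *\<^sub>R x + t *\<^sub>R \<xi> = 2 *\<^sub>R (x + (t/2) *\<^sub>R \<xi>)" for t by (simp add: algebra_simps)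
  moreover have "2 *\<^sub>R (x + t *\<^sub>R \<xi>) = 2 *\<^sub>R x + (2*t) *\<^sub>R \<xi>" for t by (simp add: algebra_simps)
  ultimately have "line (2 *\<^sub>R x) \<xi> = (*\<^sub>R) 2 ` line x \<xi>"
    unfolding line_def image_image
    by (metis (no_types, lifting) image_cong rangeE rangeI subsetI subset_antisym)
  then show ?thesis by simp
qed

lemma touching_cylinders_eq:
  "touching_cylinders = (\<lambda>(x, \<xi>). solid_cylinder 1 (line (2 *\<^sub>R x) \<xi>)) ` unit_tangents"
proof (intro equalityI subsetI)
  fix C assume "C \<in> touching_cylinders"
  then obtain a v where v: "norm v = 1" and C: "C = solid_cylinder 1 (line a v)"
    and t: "touches_unit_ball C"
    by (auto simp: touching_cylinders_def unit_cylinder_def)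
  have n2: "norm (perp v a) = 2" using t touching_solid_cylinder_iff[OF v] C by simp
  have "perp v a = a + (- (a \<bullet> v)) *\<^sub>R v" by (simp add: perp_def)
  then have "C = solid_cylinder 1 (line (2 *\<^sub>R ((1/2) *\<^sub>R perp v a)) v)"
    using C by (simp add: line_shift del: scaleR_minus_left)
  moreover have "((1/2) *\<^sub>R perp v a, v) \<in> unit_tangents"
    using n2 v perp_inner[OF v] by (simp add: unit_tangents_def)
  ultimately show "C \<in> (\<lambda>(x, \<xi>). solid_cylinder 1 (line (2 *\<^sub>R x) \<xi>)) ` unit_tangents"
    by force
next
  fix C assume "C \<in> (\<lambda>(x, \<xi>). solid_cylinder 1 (line (2 *\<^sub>R x) \<xi>)) ` unit_tangents"
  then obtain x v where C: "C = solid_cylinder 1 (line (2 *\<^sub>R x) v)"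
    and x: "norm x = 1" "norm v = 1" "x \<bullet> v = 0"
    by (auto simp: unit_tangents_def)
  have "perp v (2 *\<^sub>R x) = 2 *\<^sub>R x" using x by (simp add: perp_def)
  then show "C \<in> touching_cylinders"
    using x C touching_solid_cylinder_iff[of v "2 *\<^sub>R x"]
    by (auto simp: touching_cylinders_def unit_cylinder_def)
qed

lemma tangent_generator_iff:
  assumes "(x, \<xi>) \<in> unit_tangents"
  shows "generator (solid_cylinder 1 (line (2 *\<^sub>R x) \<xi>)) L \<and> L \<in> tangent_lines \<longleftrightarrow> L = line x \<xi>"
proof
  have x: "norm x = 1" "norm \<xi> = 1" "x \<bullet> \<xi> = 0" using assms by (auto simp: unit_tangents_def)
  have fr: "frontier (solid_cylinder 1 (line (2 *\<^sub>R x) \<xi>)) = {p. norm (perp \<xi> p - 2 *\<^sub>R x) = 1}"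
    using x by (simp add: frontier_solid_cylinder infdist_line perp_diff perp_scale)
      (simp add: perp_def)
  {
    assume L: "L = line x \<xi>"
    have "line x \<xi> \<subseteq> frontier (solid_cylinder 1 (line (2 *\<^sub>R x) \<xi>))"
    proof
      fix p assume "p \<in> line x \<xi>"
      then obtain t where p: "p = x + t *\<^sub>R \<xi>" by (auto simp: line_def)
      have "perp \<xi> p = x" unfolding p perp_add perp_scale perp_self[OF x(2)] using x by (simp add: perp_def)
      then have "norm (perp \<xi> p - 2 *\<^sub>R x) = norm ((1 - 2) *\<^sub>R x)"
        unfolding scaleR_left_diff_distrib by simp
      then show "p \<in> frontier (solid_cylinder 1 (line (2 *\<^sub>R x) \<xi>))"
        unfolding fr using x by simp
    qed
    then show "generator (solid_cylinder 1 (line (2 *\<^sub>R x) \<xi>)) L \<and> L \<in> tangent_lines"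
      using x assms L by (auto simp: generator_def tangent_lines_def)
  }
  {
    assume g: "generator (solid_cylinder 1 (line (2 *\<^sub>R x) \<xi>)) L \<and> L \<in> tangent_lines"
    then obtain y \<eta> where L: "L = line y \<eta>" and y: "norm y = 1" "norm \<eta> = 1" "y \<bullet> \<eta> = 0"
      by (auto simp: tangent_lines_def unit_tangents_def)
    have sub: "norm (perp \<xi> (y + t *\<^sub>R \<eta>) - 2 *\<^sub>R x) = 1" for t
    proof -
      have "y + t *\<^sub>R \<eta> \<in> L" by (auto simp: L line_def)
      then show ?thesis using g fr by (auto simp: generator_def)
    qed
    have "\<eta> = \<xi> \<or> \<eta> = - \<xi>"
    proof (rule line_bounded_direction[OF x(2) y(2)])
      fix t
      have "perp \<xi> ((y - 2 *\<^sub>R x) + t *\<^sub>R \<eta>) = perp \<xi> (y + t *\<^sub>R \<eta>) - perp \<xi> (2 *\<^sub>R x)"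
        unfolding perp_diff[symmetric] by (simp add: algebra_simps)
      also have "perp \<xi> (2 *\<^sub>R x) = 2 *\<^sub>R x" using x by (simp add: perp_def)
      finally show "norm (perp \<xi> ((y - 2 *\<^sub>R x) + t *\<^sub>R \<eta>)) \<le> 1" using sub[of t] by simp
    qed
    moreover from this have "y \<bullet> \<xi> = 0" using y by auto
    then have "norm (y - 2 *\<^sub>R x) = 1" using sub[of 0] by (simp add: perp_def)
    then have "(y - 2 *\<^sub>R x) \<bullet> (y - 2 *\<^sub>R x) = 1" by (simp add: norm_eq_1)
    then have "y \<bullet> x = 1"
      using x y by (simp add: norm_eq_1 inner_diff_left inner_diff_right inner_commute[of x y])
    then have "(y - x) \<bullet> (y - x) = 0"
      using x y by (simp add: norm_eq_1 inner_diff_left inner_diff_right inner_commute[of x y])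
    then have "y = x" by simp
    ultimately show "L = line x \<xi>" by (auto simp: L line_uminus)
  }
qed

lemma tangent_generator_solid_cylinder:
  assumes "(x, \<xi>) \<in> unit_tangents"
  shows "tangent_generator (solid_cylinder 1 (line (2 *\<^sub>R x) \<xi>)) = line x \<xi>"
  unfolding tangent_generator_def tangent_generator_iff[OF assms] by simp

lemma ex1_tangent_generator:
  assumes "C \<in> touching_cylinders"
  shows "\<exists>!L. generator C L \<and> L \<in> tangent_lines"
proof -
  obtain x \<xi> where "(x, \<xi>) \<in> unit_tangents" "C = solid_cylinder 1 (line (2 *\<^sub>R x) \<xi>)"
    using assms unfolding touching_cylinders_eq by auto
  then show ?thesis by (simp only: tangent_generator_iff) simp
qed

lemma solid_cylinder_tangent_generator:
  assumes "C \<in> touching_cylinders"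
  shows "C = solid_cylinder 1 ((*\<^sub>R) 2 ` tangent_generator C)"
  using assms unfolding touching_cylinders_eq
  by (auto simp: tangent_generator_solid_cylinder solid_cylinder_line_scale[symmetric])

lemma bij_betw_tangent_generator:
  "bij_betw tangent_generator touching_cylinders tangent_lines"
proof (rule bij_betw_imageI)
  show "inj_on tangent_generator touching_cylinders"
    by (rule inj_onI) (metis solid_cylinder_tangent_generator)
  show "tangent_generator ` touching_cylinders = tangent_lines"
    unfolding touching_cylinders_eq tangent_lines_def image_image
    by (rule image_cong) (auto simp: tangent_generator_solid_cylinder)
qed

lemma topspace_configuration_space [simp]: "topspace configuration_space = configurations"
proof -
  have "configurations \<subseteq> (\<lambda>c. \<lambda>i\<in>{1..6}. tangent_generator (c i)) -` ({1..6} \<rightarrow>\<^sub>E tangent_lines)"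
    using bij_betw_apply[OF bij_betw_tangent_generator]
    by (auto simp: configurations_def PiE_iff)
  then show ?thesis
    unfolding configuration_space_def topspace_pullback_topology topspace_product_topology
    by auto
qed

lemma interior_disjoint_iff_setdist:
  assumes "C \<in> touching_cylinders" "D \<in> touching_cylinders"
  shows "interior C \<inter> interior D = {} \<longleftrightarrow> setdist (tangent_generator C) (tangent_generator D) \<ge> 1"
proof -
  obtain x \<xi> y \<eta> where C: "C = solid_cylinder 1 (line (2 *\<^sub>R x) \<xi>)" and x: "(x, \<xi>) \<in> unit_tangents"
    and D: "D = solid_cylinder 1 (line (2 *\<^sub>R y) \<eta>)" and y: "(y, \<eta>) \<in> unit_tangents"
    using assms unfolding touching_cylinders_eq by auto
  have nx: "norm \<xi> = 1" and ny: "norm \<eta> = 1" using x y by (auto simp: unit_tangents_def)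
  have gC: "tangent_generator C = line x \<xi>" and gD: "tangent_generator D = line y \<eta>"
    using tangent_generator_solid_cylinder x y C D by auto
  have less: "infdist p (line a v) < 1 \<longleftrightarrow> (\<exists>q\<in>line a v. dist p q < 1)" for p a v
    unfolding infdist_def by (simp add: cINF_less_iff)
  have two1: "2 *\<^sub>R q \<in> line (2 *\<^sub>R a) v" if q: "q \<in> line a v" for q a v
  proof -
    obtain t where "q = a + t *\<^sub>R v" using q by (auto simp: line_def)
    then have "2 *\<^sub>R q = 2 *\<^sub>R a + (2 * t) *\<^sub>R v" by (simp add: algebra_simps)
    then show ?thesis by (auto simp: line_def)
  qed
  have two2: "(1/2) *\<^sub>R q \<in> line a v" if q: "q \<in> line (2 *\<^sub>R a) v" for q a v
  proof -
    obtain t where "q = 2 *\<^sub>R a + t *\<^sub>R v" using q by (auto simp: line_def)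
    then have "(1/2) *\<^sub>R q = a + (t/2) *\<^sub>R v" by (simp add: algebra_simps)
    then show ?thesis by (auto simp: line_def)
  qed
  have "(interior C \<inter> interior D \<noteq> {}) \<longleftrightarrow> (\<exists>a\<in>line x \<xi>. \<exists>b\<in>line y \<eta>. dist a b < 1)"
  proof
    assume "interior C \<inter> interior D \<noteq> {}"
    then obtain p a b where ab: "a \<in> line (2 *\<^sub>R x) \<xi>" "b \<in> line (2 *\<^sub>R y) \<eta>" "dist p a < 1" "dist p b < 1"
      by (auto simp: C D interior_solid_cylinder nx ny less)
    have "dist a b < 2" using dist_triangle3[of a b p] ab by simp
    moreover have "(1/2) *\<^sub>R a - (1/2) *\<^sub>R b = (1/2) *\<^sub>R (a - b)" by (simp add: scaleR_right_diff_distrib)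
    ultimately have "dist ((1/2) *\<^sub>R a) ((1/2) *\<^sub>R b) < 1" by (simp add: dist_norm)
    then show "\<exists>a\<in>line x \<xi>. \<exists>b\<in>line y \<eta>. dist a b < 1" using two2 ab by blast
  next
    assume "\<exists>a\<in>line x \<xi>. \<exists>b\<in>line y \<eta>. dist a b < 1"
    then obtain a b where ab: "a \<in> line x \<xi>" "b \<in> line y \<eta>" "dist a b < 1" by blast
    have "dist (a + b) (2 *\<^sub>R a) < 1" "dist (a + b) (2 *\<^sub>R b) < 1"
      using ab by (simp_all add: dist_norm scaleR_2 norm_minus_commute)
    then have "a + b \<in> interior C \<inter> interior D"
      using two1 ab by (auto simp: C D interior_solid_cylinder nx ny less)
    then show "interior C \<inter> interior D \<noteq> {}" by blast
  qed
  also have "\<dots> \<longleftrightarrow> setdist (line x \<xi>) (line y \<eta>) < 1"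
  proof
    assume "\<exists>a\<in>line x \<xi>. \<exists>b\<in>line y \<eta>. dist a b < 1"
    then show "setdist (line x \<xi>) (line y \<eta>) < 1"
      by (meson setdist_le_dist le_less_trans)
  next
    assume lt: "setdist (line x \<xi>) (line y \<eta>) < 1"
    show "\<exists>a\<in>line x \<xi>. \<exists>b\<in>line y \<eta>. dist a b < 1"
    proof (rule ccontr)
      assume "\<not> ?thesis"
      then have "\<And>a b. a \<in> line x \<xi> \<Longrightarrow> b \<in> line y \<eta> \<Longrightarrow> 1 \<le> dist a b" by force
      then have "1 \<le> setdist (line x \<xi>) (line y \<eta>)" by (intro le_setdistI) auto
      then show False using lt by simp
    qed
  qed
  finally show ?thesis unfolding gC gD by linarith
qed

lemma homeomorphic_map_configuration_space:
  "homeomorphic_map configuration_space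
     (subtopology (product_topology (\<lambda>_. tangent_line_topology) {1..6::nat})
        {u. \<forall>i\<in>{1..6}. \<forall>j\<in>{1..6}. i \<noteq> j \<longrightarrow> setdist (u i) (u j) \<ge> 1})
     (\<lambda>c. \<lambda>i\<in>{1..6}. tangent_generator (c i))"
  (is "homeomorphic_map _ (subtopology ?P ?S) ?f")
proof -
  have top: "topspace (subtopology ?P ?S) = ({1..6} \<rightarrow>\<^sub>E tangent_lines) \<inter> ?S"
    by simp
  have inj: "inj_on ?f configurations"
  proof (rule inj_onI)
    fix c d assume c: "c \<in> configurations" and d: "d \<in> configurations" and eq: "?f c = ?f d"
    have ext: "c \<in> extensional {1..6}" "d \<in> extensional {1..6}"
      and mem: "\<And>i. i \<in> {1..6} \<Longrightarrow> c i \<in> touching_cylinders \<and> d i \<in> touching_cylinders"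
      using c d by (auto simp: configurations_def PiE_iff)
    show "c = d"
    proof (rule extensionalityI[OF ext])
      fix i :: nat assume i: "i \<in> {1..6}"
      have "tangent_generator (c i) = tangent_generator (d i)" using fun_cong[OF eq, of i] i by simp
      then show "c i = d i" using mem[OF i] by (metis solid_cylinder_tangent_generator)
    qed
  qed
  have img: "?f ` configurations = ({1..6} \<rightarrow>\<^sub>E tangent_lines) \<inter> ?S"
  proof (intro equalityI subsetI)
    fix u assume "u \<in> ?f ` configurations"
    then obtain c where c: "c \<in> configurations" and u: "u = ?f c" by blast
    have mem: "c i \<in> touching_cylinders" if "i \<in> {1..6}" for i
      using c that by (auto simp: configurations_def)
    have "u \<in> {1..6} \<rightarrow>\<^sub>E tangent_lines"
      unfolding u using bij_betw_apply[OF bij_betw_tangent_generator] mem by auto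
    moreover have "setdist (u i) (u j) \<ge> 1" if "i \<in> {1..6}" "j \<in> {1..6}" "i \<noteq> j" for i j
    proof -
      have "interior (c i) \<inter> interior (c j) = {}" using c that unfolding configurations_def by blast
      then show ?thesis using that mem by (simp add: u interior_disjoint_iff_setdist)
    qed
    ultimately show "u \<in> ({1..6} \<rightarrow>\<^sub>E tangent_lines) \<inter> ?S" by blast
  next
    fix u assume u: "u \<in> ({1..6} \<rightarrow>\<^sub>E tangent_lines) \<inter> ?S"
    define c where "c = (\<lambda>i\<in>{1..6}. inv_into touching_cylinders tangent_generator (u i))"
    have c: "c i \<in> touching_cylinders" "tangent_generator (c i) = u i" if i: "i \<in> {1..6}" for i
    proof -
      have "u i \<in> tangent_generator ` touching_cylinders"
        using u i bij_betw_imp_surj_on[OF bij_betw_tangent_generator] by auto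
      then show "c i \<in> touching_cylinders" "tangent_generator (c i) = u i"
        using i unfolding c_def by (simp_all only: restrict_apply' inv_into_into f_inv_into_f)
    qed
    have "c \<in> {1..6} \<rightarrow>\<^sub>E touching_cylinders"
    proof (rule PiE_I)
      fix i :: nat assume "i \<in> {1..6}" then show "c i \<in> touching_cylinders" by (rule c)
    next
      fix i :: nat assume "i \<notin> {1..6}" then show "c i = undefined" unfolding c_def by (rule restrict_apply[THEN trans, OF if_not_P])
    qed
    moreover have "interior (c i) \<inter> interior (c j) = {}" if "i \<in> {1..6}" "j \<in> {1..6}" "i \<noteq> j" for i j
      unfolding interior_disjoint_iff_setdist[OF c(1)[OF that(1)] c(1)[OF that(2)]]
      unfolding c(2)[OF that(1)] c(2)[OF that(2)] using u that by blast
    ultimately have "c \<in> configurations" unfolding configurations_def by blast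
    moreover have "?f c = u"
    proof (rule extensionalityI[of _ "{1..6}"])
      show "u \<in> extensional {1..6}" using u by (simp add: PiE_iff)
    next
      fix i :: nat assume i: "i \<in> {1..6}"
      show "?f c i = u i" using c(2)[OF i] i by simp
    qed simp
    ultimately show "u \<in> ?f ` configurations" by blast
  qed
  have op: "openin configuration_space V \<longleftrightarrow> (\<exists>U. openin ?P U \<and> V = ?f -` U \<inter> configurations)" for V
    unfolding configuration_space_def by (rule openin_pullback_topology)
  have "openin configuration_space {c \<in> configurations. ?f c \<in> V} \<longleftrightarrow> openin (subtopology ?P ?S) V"
    if V: "V \<subseteq> ?f ` configurations" for V
  proof
    assume "openin configuration_space {c \<in> configurations. ?f c \<in> V}"
    then obtain U where U: "openin ?P U"
      and eq: "{c \<in> configurations. ?f c \<in> V} = ?f -` U \<inter> configurations"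
      unfolding op by blast
    have "V = U \<inter> ?f ` configurations" using V eq by blast
    also have "\<dots> = U \<inter> ?S"
      unfolding img using openin_subset[OF U] by auto
    finally show "openin (subtopology ?P ?S) V" unfolding openin_subtopology using U by blast
  next
    assume "openin (subtopology ?P ?S) V"
    then obtain U where U: "openin ?P U" "V = U \<inter> ?S" unfolding openin_subtopology by blast
    have "{c \<in> configurations. ?f c \<in> V} = ?f -` U \<inter> configurations"
      using img unfolding U(2) by blast
    then show "openin configuration_space {c \<in> configurations. ?f c \<in> V}" unfolding op using U by blast
  qed
  then have "quotient_map configuration_space (subtopology ?P ?S) ?f"
    unfolding quotient_map_def top topspace_configuration_space img by blast
  then show ?thesis
    unfolding homeomorphic_map_def topspace_configuration_space using inj by blast
qed

end

theory Submission
  imports Defs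
begin

text \<open>
  Indices a are taken modulo 3, signs s, t are 1 or -1, and e(a) is the standard basis. The octahedral
  configuration consists of the tangent lines at the six points s e(a) with direction e(a+1). Any two
  of its lines that are not antipodal are at distance exactly 1, and it is locked: nearby, only its
  rotations satisfy the distance constraints. What is proved here is a quantitative form of this that
  needs no choice of a rotation: an open condition of closeness to the octahedral configuration
  implies a strictly stronger closed one (\<open>configuration_gap\<close>). Such a condition defines an open and
  closed set of configurations. It is not empty, and it is not everything, because the octahedral
  configuration with its labels permuted violates it.

  A tangent line at x with direction \<open>\<xi>\<close> has the moment \<open>m = x \<times> \<xi>\<close>. Two lines at distance at
  least 1 satisfy \<open>(m \<bullet> \<xi>' + \<xi> \<bullet> m')\<^sup>2 + (\<xi> \<bullet> \<xi>')\<^sup>2 \<ge> 1\<close> (\<open>tangent_lines_separation\<close>), where the points of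
  tangency occur only through the moments. Up to the signs of \<open>\<xi>\<close> and m, up to rotation, and up to
  exchanging the two lines with the same index, the octahedral configuration is characterised among
  all configurations by \<open>m a s = \<xi> (a + 1) t\<close> for all a, s, t. Suppose that these equations hold up to an
  error E. Then \<open>s t (\<xi> a s \<bullet> m (a + 1) t) \<ge> \<parallel>r\<parallel>\<^sup>2 / 2 - O(E\<^sup>4)\<close> (\<open>signed_w\<close>), where r is the part of
  \<open>m a s - \<xi> (a + 1) t\<close> orthogonal to \<open>\<xi> a s\<close>. To first order the left-hand sides for the four choices
  of s and t sum to zero, so each of them vanishes to first order. Up to a common rotation this leaves
  the motions in which every line turns about its normal at the point of tangency; let p(a) be the
  relative angle of the two lines with index a. Up to errors of third order, the sum of the four
  left-hand sides is \<open>- p a p (a + 1)\<close> (\<open>K_p\<close>), and the sum of the four \<open>\<parallel>r\<parallel>\<^sup>2\<close> is at least \<open>(p (a + 1))\<^sup>2\<close> (\<open>p_le_res\<close>), whence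
  \<open>(p (a + 1))\<^sup>2 \<le> - 2 p a p (a + 1) + O(E\<^sup>3)\<close> for all three a (\<open>p_quadratic\<close>).

  No combination of these three inequalities with nonnegative weights has a positive definite
  quadratic part, so a single Lagrange multiplier cannot finish the proof. Together they do: the
  product of \<open>p 1 p 2\<close>, \<open>p 2 p 3\<close> and \<open>p 3 p 1\<close> is a square, so one of the three factors is nonnegative,
  which makes one p(a) small, and then the next two (\<open>cyclic_quadratic_bound\<close>). Hence the squares
  of all p(a), and with them the squared errors \<open>\<parallel>m a s - \<xi> (a + 1) t\<parallel>\<^sup>2\<close>, are \<open>O(E\<^sup>3)\<close>, which for small E
  is below \<open>E\<^sup>2 / 4\<close> (\<open>closeness_improves\<close>).
\<close>

section \<open>Elementary inequalities\<close>

lemma cyclic_add_3: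
  fixes a :: 3
  shows "a + 1 + 1 = a + 2" "a + 1 + 2 = a" "a + 2 + 1 = a" "a + 2 + 2 = a + 1"
  using exhaust_3[of a] by auto

lemma abs_inner_le:
  fixes u v :: "'a::real_inner"
  assumes "norm u \<le> b" "norm v \<le> c"
  shows "\<bar>u \<bullet> v\<bar> \<le> b * c"
  by (meson assms Cauchy_Schwarz_ineq2 mult_mono norm_ge_zero order_trans)

definition sg :: "bool \<Rightarrow> real" where "sg s = (if s then 1 else -1)"

text \<open>With \<open>p * q \<ge> 0\<close> the first inequality bounds \<open>q\<close> by \<open>\<surd>h\<close>. The other two then pass a bound
  from \<open>q\<close> to \<open>r\<close> and from \<open>r\<close> to \<open>p\<close>, worsening the factor \<open>c\<close> to \<open>2 * c + 1\<close> each time.\<close>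

lemma cyclic_quadratic_bound_aux:
  fixes p q r h :: real
  assumes h: "0 \<le> h" and pq: "0 \<le> p * q"
    and q: "q\<^sup>2 \<le> -2 * (p * q) + h" and r: "r\<^sup>2 \<le> -2 * (q * r) + h" and p: "p\<^sup>2 \<le> -2 * (r * p) + h"
  shows "\<bar>p * q\<bar> \<le> 21 * h \<and> \<bar>q * r\<bar> \<le> 21 * h \<and> \<bar>r * p\<bar> \<le> 21 * h"
proof -
  define k where "k = sqrt h"
  have k: "0 \<le> k" "k * k = h" using h by (auto simp: k_def)
  have step: "\<bar>y\<bar> \<le> (2 * c + 1) * k" if "\<bar>x\<bar> \<le> c * k" "y\<^sup>2 \<le> -2 * (x * y) + h" "0 \<le> c" for x y c :: real
  proof (rule ccontr)
    assume n: "\<not> ?thesis"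
    have "-2 * (x * y) \<le> 2 * (\<bar>x\<bar> * \<bar>y\<bar>)" by (simp flip: abs_mult)
    also have "\<dots> \<le> 2 * (c * k * \<bar>y\<bar>)" using that by (simp add: mult_right_mono)
    finally have 1: "\<bar>y\<bar> * \<bar>y\<bar> \<le> 2 * (c * k * \<bar>y\<bar>) + h" using that by (simp add: power2_eq_square)
    have "0 \<le> c * k" using k that by simp
    then have ky: "k \<le> \<bar>y\<bar>" "0 < \<bar>y\<bar>" using n k by (auto simp: algebra_simps)
    have "(2 * c + 1) * k * \<bar>y\<bar> < \<bar>y\<bar> * \<bar>y\<bar>" using n ky k
      by (intro mult_strict_right_mono) auto
    moreover have "k * k \<le> k * \<bar>y\<bar>" using ky k by (intro mult_left_mono) auto
    ultimately show False using 1 k by (simp add: algebra_simps)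
  qed
  have "\<bar>q\<bar>\<^sup>2 \<le> h" using q pq by simp
  then have bq: "\<bar>q\<bar> \<le> 1 * k" unfolding k_def by (simp add: real_le_rsqrt)
  have br: "\<bar>r\<bar> \<le> 3 * k" using step[OF bq r] by simp
  have bp: "\<bar>p\<bar> \<le> 7 * k" using step[OF br p] by simp
  have "\<bar>p\<bar> * \<bar>q\<bar> \<le> 7 * k * (1 * k)" using bp bq k by (intro mult_mono) auto
  moreover have "\<bar>q\<bar> * \<bar>r\<bar> \<le> 1 * k * (3 * k)" using bq br k by (intro mult_mono) auto
  moreover have "\<bar>r\<bar> * \<bar>p\<bar> \<le> 3 * k * (7 * k)" using br bp k by (intro mult_mono) auto
  moreover have "7 * k * (1 * k) = 7 * h" "1 * k * (3 * k) = 3 * h" "3 * k * (7 * k) = 21 * h"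
    using k(2) by auto
  ultimately show ?thesis using h unfolding abs_mult by linarith
qed

text \<open>The three products cannot all be negative, because their product is the square of \<open>p * q * r\<close>;
  the hypotheses are cyclically symmetric, so it does not matter which one is nonnegative.\<close>

lemma cyclic_quadratic_bound:
  fixes p q r h :: real
  assumes h: "0 \<le> h"
    and q: "q\<^sup>2 \<le> -2 * (p * q) + h" and r: "r\<^sup>2 \<le> -2 * (q * r) + h" and p: "p\<^sup>2 \<le> -2 * (r * p) + h"
  shows "\<bar>p * q\<bar> \<le> 21 * h \<and> \<bar>q * r\<bar> \<le> 21 * h \<and> \<bar>r * p\<bar> \<le> 21 * h"
proof -
  have "0 \<le> p * q \<or> 0 \<le> q * r \<or> 0 \<le> r * p"
  proof (rule ccontr)
    assume "\<not> ?thesis"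
    then have "0 < (p * q) * (q * r)" "r * p < 0" by (simp_all add: mult_neg_neg)
    then have "((p * q) * (q * r)) * (r * p) < 0" by (rule mult_pos_neg)
    moreover have "((p * q) * (q * r)) * (r * p) = (p * q * r)\<^sup>2" by (simp add: power2_eq_square)
    ultimately show False by simp
  qed
  then show ?thesis
  proof (elim disjE)
    assume "0 \<le> p * q" then show ?thesis by (rule cyclic_quadratic_bound_aux[OF h _ q r p])
  next
    assume "0 \<le> q * r" then show ?thesis using cyclic_quadratic_bound_aux[OF h _ r p q] by blast
  next
    assume "0 \<le> r * p" then show ?thesis using cyclic_quadratic_bound_aux[OF h _ p q r] by blast
  qed
qed

section \<open>Rigidity of the octahedral configuration\<close>

lemma orthonormal_cross_expand:
  fixes x y v :: "real^3"
  assumes "norm x = 1" "norm y = 1" "x \<bullet> y = 0"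
  shows "v = (v \<bullet> cross3 x y) *\<^sub>R cross3 x y + (v \<bullet> x) *\<^sub>R x + (v \<bullet> y) *\<^sub>R y"
proof -
  define n where "n = cross3 x y"
  have n: "n \<bullet> x = 0" "n \<bullet> y = 0" "x \<bullet> n = 0" "y \<bullet> n = 0" "n \<bullet> n = 1"
    using norm_cross[of x y] assms
    by (simp_all add: n_def dot_cross_self power2_norm_eq_inner)
  have xy: "x \<bullet> x = 1" "y \<bullet> y = 1" "y \<bullet> x = 0" using assms by (simp_all add: norm_eq_1 inner_commute)
  define z where "z = v - ((v \<bullet> n) *\<^sub>R n + (v \<bullet> x) *\<^sub>R x + (v \<bullet> y) *\<^sub>R y)"
  have z: "z \<bullet> n = 0" "z \<bullet> x = 0" "z \<bullet> y = 0"
    by (simp_all add: z_def inner_simps n xy assms)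
  have "cross3 z n = 0" unfolding n_def Lagrange by (simp add: z)
  then have "z = 0" using norm_and_cross_eq_0[of z n] z(1) n(5) by auto
  then show ?thesis unfolding z_def n_def by (simp only: right_minus_eq)
qed

text \<open>The directions \<open>\<xi> a s\<close> and moments \<open>m a s\<close> of six tangent lines whose signs have been adjusted so
  that \<open>m a s\<close> is close to \<open>\<xi> (a + 1) t\<close>. After this adjustment \<open>\<xi> a s\<close>, \<open>m a s\<close> and the point of
  tangency need no longer form a positively oriented frame; the factor \<open>sg s * sg t\<close> in the
  separation condition records the orientations, which are opposite for the two sides \<open>s\<close>.
  The bound on \<open>E\<close> is chosen so that \<open>(4267 + 8600) * E ^ 3\<close>, the sum of the bounds for the residual
  and for \<open>Q\<close>, is below \<open>E\<^sup>2 / 4\<close>.\<close>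

locale octahedral_frames =
  fixes \<xi> m :: "3 \<Rightarrow> bool \<Rightarrow> real^3" and E :: real
  assumes unit_\<xi>: "norm (\<xi> a s) = 1" and unit_m: "norm (m a s) = 1" and orth: "\<xi> a s \<bullet> m a s = 0"
    and E_pos: "0 < E" and E_small: "E \<le> 1/100000"
    and close: "norm (m a s - \<xi> (a + 1) t) \<le> E"
    and separated: "1 \<le> (m a s \<bullet> \<xi> (a + 1) t + sg s * sg t * (\<xi> a s \<bullet> m (a + 1) t))\<^sup>2
      + (\<xi> a s \<bullet> \<xi> (a + 1) t)\<^sup>2"
begin

text \<open>The quantity \<open>w\<close> is the first-order part of the separation condition, \<open>Q\<close> is its remaining
  inner product, and \<open>res\<close> is the projection of \<open>m a s - \<xi> (a + 1) t\<close> to the orthogonal complement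
  of \<open>\<xi> a s\<close>. The signed sum of the four \<open>w a s t\<close> is the quadratic quantity \<open>K a\<close>.\<close>

definition w where "w a s t = \<xi> a s \<bullet> m (a + 1) t"
definition Q where "Q a s t = \<xi> a s \<bullet> \<xi> (a + 1) t"
definition res where "res a s t = m a s - \<xi> (a + 1) t + Q a s t *\<^sub>R \<xi> a s"
definition \<delta>\<xi> where "\<delta>\<xi> a = \<xi> a True - \<xi> a False"
definition \<delta>m where "\<delta>m a = m a True - m a False"
definition K where "K a = \<delta>\<xi> a \<bullet> \<delta>m (a + 1)"

lemma orth': "m a s \<bullet> \<xi> a s = 0" using orth by (simp add: inner_commute)
lemma inner_self: "\<xi> a s \<bullet> \<xi> a s = 1" "m a s \<bullet> m a s = 1"
  using unit_\<xi> unit_m by (simp_all add: norm_eq_1)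

lemma close3: "norm (m (a + 2) s - \<xi> a t) \<le> E" "norm (m (a + 1) s - \<xi> (a + 2) t) \<le> E"
  using close[of "a + 2" s t] close[of "a + 1" s t] by (simp_all add: cyclic_add_3)

lemma E_powers: "E ^ 4 \<le> E ^ 3 / 100000" "E ^ 3 \<le> E\<^sup>2 / 100000" "E\<^sup>2 \<le> E / 100000" "0 < E ^ 4" "0 < E^3" "0 < E\<^sup>2"
proof -
  have *: "E ^ Suc n \<le> E ^ n / 100000" for n
    using mult_right_mono[OF E_small, of "E ^ n"] E_pos by simp
  show "E ^ 4 \<le> E ^ 3 / 100000" "E ^ 3 \<le> E\<^sup>2 / 100000" "E\<^sup>2 \<le> E / 100000"
    using *[of 3] *[of 2] *[of 1] by (simp_all add: eval_nat_numeral)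
  show "0 < E ^ 4" "0 < E^3" "0 < E\<^sup>2" using E_pos by simp_all
qed

lemma norm_\<delta>\<xi>: "norm (\<delta>\<xi> a) \<le> 2 * E"
  using close3(1)[of a True False] close3(1)[of a True True]
    norm_triangle_ineq4[of "m (a + 2) True - \<xi> a False" "m (a + 2) True - \<xi> a True"]
  by (simp add: \<delta>\<xi>_def)

lemma norm_\<delta>m: "norm (\<delta>m a) \<le> 2 * E"
  using close[of a True True] close[of a False True]
    norm_triangle_ineq4[of "m a True - \<xi> (a + 1) True" "m a False - \<xi> (a + 1) True"]
  by (simp add: \<delta>m_def)

text \<open>Here the index \<open>a + 2\<close> mediates: \<open>m (a + 1) t\<close> is close to \<open>\<xi> (a + 2) t\<close> and \<open>\<xi> a s\<close> is close to
  \<open>m (a + 2) t\<close>, and these two vectors are orthogonal.\<close>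

lemma w_coarse: "\<bar>w a s t\<bar> \<le> 2 * E"
proof -
  have "w a s t = \<xi> a s \<bullet> (m (a + 1) t - \<xi> (a + 2) t) - (m (a + 2) t - \<xi> a s) \<bullet> \<xi> (a + 2) t"
    by (simp add: w_def inner_diff_left inner_diff_right orth')
  moreover have "\<bar>\<xi> a s \<bullet> (m (a + 1) t - \<xi> (a + 2) t)\<bar> \<le> 1 * E"
    by (intro abs_inner_le) (simp_all add: unit_\<xi> close3)
  moreover have "\<bar>(m (a + 2) t - \<xi> a s) \<bullet> \<xi> (a + 2) t\<bar> \<le> E * 1"
    by (intro abs_inner_le) (simp_all add: unit_\<xi> close3)
  ultimately show ?thesis by linarith
qed

lemma Q_alt: "Q a s t = - (\<xi> a s \<bullet> (m a s - \<xi> (a + 1) t))"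
  by (simp add: Q_def inner_diff_right orth)

lemma Q_coarse: "\<bar>Q a s t\<bar> \<le> E"
  using abs_inner_le[of "\<xi> a s" 1 "m a s - \<xi> (a + 1) t" E] by (simp add: Q_alt unit_\<xi> close)

lemma norm_res: "(norm (m a s - \<xi> (a + 1) t))\<^sup>2 = (norm (res a s t))\<^sup>2 + (Q a s t)\<^sup>2"
  unfolding power2_norm_eq_inner res_def Q_def
  by (simp add: inner_simps inner_self orth orth' inner_commute power2_eq_square algebra_simps)

lemma inner_m_\<xi>: "m a s \<bullet> \<xi> (a + 1) t = 1 - (norm (m a s - \<xi> (a + 1) t))\<^sup>2 / 2"
  unfolding power2_norm_eq_inner by (simp add: inner_simps inner_self inner_commute[of "\<xi> (a + 1) t"] diff_divide_distrib)

text \<open>The separation condition is solved for \<open>w\<close>. The quadratic part \<open>Q\<^sup>2 / 2\<close> of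
  \<open>1 - \<surd>(1 - Q\<^sup>2)\<close> cancels the component of \<open>m a s - \<xi> (a + 1) t\<close> along \<open>\<xi> a s\<close>, so that
  only the residual and an error of fourth order remain.\<close>

lemma signed_w: "(norm (res a s t))\<^sup>2 / 2 - E ^ 4 / 2 \<le> sg s * sg t * w a s t"
proof -
  define P where "P = m a s \<bullet> \<xi> (a + 1) t + sg s * sg t * w a s t"
  define q where "q = (Q a s t)\<^sup>2"
  have q: "0 \<le> q" "q \<le> E\<^sup>2" using power_mono[OF Q_coarse[of a s t], of 2] by (simp_all add: q_def)
  have q1: "q \<le> 1" using q E_powers E_small by linarith
  have sep: "1 - q \<le> P\<^sup>2" using separated[of a s t] by (simp add: P_def q_def w_def Q_def)
  have "(norm (m a s - \<xi> (a + 1) t))\<^sup>2 \<le> E\<^sup>2" using close[of a s t] by (simp add: power_mono)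
  moreover have "\<bar>sg s * sg t * w a s t\<bar> \<le> 2 * E"
    using w_coarse[of a s t] by (cases s; cases t) (simp_all add: sg_def)
  ultimately have "0 \<le> P" using E_powers(3) E_small unfolding P_def inner_m_\<xi> by linarith
  \<comment> \<open>A polynomial lower bound of \<open>\<surd>(1 - q)\<close> on the unit interval.\<close>
  have "(1 - q / 2 - q\<^sup>2 / 2)\<^sup>2 \<le> 1 - q"
  proof -
    define y where "y = q / 2"
    have "(1 - 2 * y) - (1 - y - 2 * (y * y)) * (1 - y - 2 * (y * y)) = y * y * ((1 - 2 * y) * (3 + 2 * y))"
      by (simp add: algebra_simps)
    moreover have "0 \<le> y * y * ((1 - 2 * y) * (3 + 2 * y))"
      using q q1 by (intro mult_nonneg_nonneg) (simp_all add: y_def)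
    moreover have "q = 2 * y" "q\<^sup>2 / 2 = 2 * (y * y)" by (simp_all add: y_def power2_eq_square)
    ultimately show ?thesis by (simp only: power2_eq_square) simp
  qed
  then have "1 - q / 2 - q\<^sup>2 / 2 \<le> P" using power2_le_imp_le[OF order_trans[OF _ sep] \<open>0 \<le> P\<close>] by blast
  moreover have "q\<^sup>2 \<le> E ^ 4" using power_mono[OF q(2,1), of 2] by simp
  moreover have "P = 1 - (norm (res a s t))\<^sup>2 / 2 - q / 2 + sg s * sg t * w a s t"
    unfolding P_def inner_m_\<xi> norm_res q_def by (simp add: add_divide_distrib)
  ultimately show ?thesis by linarith
qed

text \<open>The signed sum factors as an inner product of differences, so it is of second order although
  its terms are a priori of first order.\<close>

lemma K_sum: "K a = (\<Sum>s\<in>UNIV. \<Sum>t\<in>UNIV. sg s * sg t * w a s t)"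
  by (simp add: UNIV_bool K_def \<delta>\<xi>_def \<delta>m_def w_def sg_def inner_simps)

lemma sum_res_le: "(\<Sum>s\<in>UNIV. \<Sum>t\<in>UNIV. (norm (res a s t))\<^sup>2) \<le> 2 * K a + 4 * E ^ 4"
proof -
  have "(\<Sum>s\<in>UNIV. \<Sum>t\<in>UNIV. (norm (res a s t))\<^sup>2 / 2 - E ^ 4 / 2) \<le> K a"
    unfolding K_sum by (intro sum_mono signed_w)
  then show ?thesis by (simp add: UNIV_bool)
qed

lemma res_le: "(norm (res a s t))\<^sup>2 \<le> 2 * K a + 4 * E ^ 4"
proof -
  have "(norm (res a s t))\<^sup>2 \<le> (\<Sum>t\<in>UNIV. (norm (res a s t))\<^sup>2)"
    by (rule member_le_sum) auto
  also have "\<dots> \<le> (\<Sum>s\<in>UNIV. \<Sum>t\<in>UNIV. (norm (res a s t))\<^sup>2)"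
    by (rule member_le_sum[where f = "\<lambda>s. \<Sum>t\<in>UNIV. (norm (res a s t))\<^sup>2"]) (auto intro: sum_nonneg)
  finally show ?thesis using sum_res_le[of a] by linarith
qed

text \<open>Each of the four signed numbers \<open>w a s t\<close> is bounded below by a fourth-order term, and their sum is
  of second order; so they are of second order themselves.\<close>

lemma w_fine: "\<bar>w a s t\<bar> \<le> 5 * E\<^sup>2"
proof -
  have lo: "- (E ^ 4) / 2 \<le> sg s * sg t * w a s t" for s t
    using signed_w[of a s t] zero_le_power2[of "norm (res a s t)"] by linarith
  have "K a \<le> 4 * E\<^sup>2"
    using abs_inner_le[OF norm_\<delta>\<xi> norm_\<delta>m, of a "a + 1"] by (simp add: K_def power2_eq_square)
  moreover have "K a = sg True * sg True * w a True True + sg True * sg False * w a True False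
      + sg False * sg True * w a False True + sg False * sg False * w a False False"
    by (simp add: K_sum UNIV_bool)
  ultimately have hi: "sg s * sg t * w a s t \<le> 4 * E\<^sup>2 + 2 * E ^ 4" for s t
    using lo[of True True] lo[of True False] lo[of False True] lo[of False False] E_powers(4)
    by - (induct s; induct t; linarith)
  have "\<bar>sg s * sg t * w a s t\<bar> \<le> 4 * E\<^sup>2 + 2 * E ^ 4"
    using hi[of s t] lo[of s t] E_powers(4,6) by linarith
  then have "\<bar>w a s t\<bar> \<le> 4 * E\<^sup>2 + 2 * E ^ 4" by (simp add: abs_mult sg_def split: if_splits)
  then show ?thesis using E_powers by linarith
qed

text \<open>The triple \<open>f\<close> is the frame of one line: its direction, its moment, and their cross product with
  a sign. The sign has to be read off from \<open>m 2 True\<close> because the handedness of the adjusted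
  frames is not prescribed. The other vectors are near \<open>f\<close> by chaining the hypotheses \<open>close\<close>.\<close>

lemma exists_frame:
  obtains f :: "3 \<Rightarrow> real^3" where
    "\<And>a. norm (f a) = 1" "\<And>a. f a \<bullet> f (a + 1) = 0"
    "\<And>u v. u \<bullet> v = (\<Sum>a\<in>UNIV. (u \<bullet> f a) * (v \<bullet> f a))"
    "\<And>a s. norm (\<xi> a s - f (a + 1)) \<le> 4 * E" "\<And>a s. norm (m a s - f (a + 2)) \<le> 4 * E"
proof -
  define f2 where "f2 = \<xi> 1 True"
  define f3 where "f3 = m 1 True"
  define n where "n = cross3 f2 f3"
  define f1 where "f1 = (if 0 \<le> m 2 True \<bullet> n then n else - n)"
  define f :: "3 \<Rightarrow> real^3" where "f a = (if a = 1 then f1 else if a = 2 then f2 else f3)" for a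
  have u: "norm f2 = 1" "norm f3 = 1" "f2 \<bullet> f3 = 0" by (simp_all add: f2_def f3_def unit_\<xi> unit_m orth)
  have "(norm n)\<^sup>2 = 1\<^sup>2" using norm_cross[of f2 f3] u by (simp add: n_def)
  then have n: "norm n = 1" "n \<bullet> f2 = 0" "n \<bullet> f3 = 0"
    using power2_eq_iff_nonneg[of "norm n" 1] by (simp_all add: n_def dot_cross_self)
  have f1: "norm f1 = 1" "f1 \<bullet> f2 = 0" "f1 \<bullet> f3 = 0" "0 \<le> m 2 True \<bullet> f1" using n by (auto simp: f1_def)
  have expand: "v \<bullet> v' = (v \<bullet> f1) * (v' \<bullet> f1) + (v \<bullet> f2) * (v' \<bullet> f2) + (v \<bullet> f3) * (v' \<bullet> f3)" for v v'
  proof -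
    have "(v \<bullet> f1) * (v' \<bullet> f1) = (v \<bullet> n) * (v' \<bullet> n)" by (simp add: f1_def)
    moreover have "v = (v \<bullet> n) *\<^sub>R n + (v \<bullet> f2) *\<^sub>R f2 + (v \<bullet> f3) *\<^sub>R f3"
      unfolding n_def by (rule orthonormal_cross_expand[OF u])
    then have "v \<bullet> v' = ((v \<bullet> n) *\<^sub>R n + (v \<bullet> f2) *\<^sub>R f2 + (v \<bullet> f3) *\<^sub>R f3) \<bullet> v'"
      by (rule arg_cong[where f = "\<lambda>z. z \<bullet> v'"])
    ultimately show ?thesis by (simp add: inner_simps inner_commute)
  qed
  have three: "(3::3) + 1 = 1" "(3::3) + 2 = 2" "(2::3) + 2 = 1" "(2::3) + 1 = 3" "(1::3) + 1 = 2" "(1::3) + 2 = 3" by simp_all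
  have c1: "norm (m 1 s - \<xi> 2 t) \<le> E" and c2: "norm (m 2 s - \<xi> 3 t) \<le> E" and c3: "norm (m 3 s - \<xi> 1 t) \<le> E" for s t
    using close[of 1 s t] close[of 2 s t] close[of 3 s t] by (simp_all only: three)
  have x2: "norm (\<xi> 2 t - f3) \<le> E" for t using c1[of True t] by (simp add: f3_def norm_minus_commute)
  have m3: "norm (m 3 t - f2) \<le> E" for t using c3[of t True] by (simp add: f2_def)
  have m1: "norm (m 1 s - f3) \<le> 2 * E" for s
    using norm_triangle_ineq[of "m 1 s - \<xi> 2 True" "\<xi> 2 True - f3"] c1[of s True] x2[of True] by simp
  have x1: "norm (\<xi> 1 s - f2) \<le> 2 * E" for s
    using norm_triangle_ineq4[of "m 3 True - f2" "m 3 True - \<xi> 1 s"] c3[of True s] m3[of True] by simp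
  have xf2: "\<bar>\<xi> 3 r \<bullet> f2\<bar> \<le> E" for r
    using abs_inner_le[OF eq_refl[OF unit_\<xi>] m3, of 3 r r] by (simp add: inner_diff_right orth)
  have mf3: "\<bar>m 2 r \<bullet> f3\<bar> \<le> E" for r
    using abs_inner_le[OF eq_refl[OF unit_m] x2, of 2 r r] by (simp add: inner_diff_right orth')
  have mf2: "\<bar>m 2 r \<bullet> f2\<bar> \<le> 2 * E" for r
    using abs_inner_le[OF c2 eq_refl[OF u(1)], of r r] xf2[of r] by (simp add: inner_diff_left)
  have xf3: "\<bar>\<xi> 3 r \<bullet> f3\<bar> \<le> 2 * E" for r
    using abs_inner_le[OF c2 eq_refl[OF u(2)], of r r] mf3[of r] by (simp add: inner_diff_left)
  \<comment> \<open>A unit vector almost orthogonal to \<open>f2\<close> and \<open>f3\<close> is near \<open>f1\<close> or near \<open>- f1\<close>; the last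
    condition excludes the latter.\<close>
  have near: "norm (v - f1) \<le> 4 * E"
    if v: "norm v = 1" and a: "\<bar>v \<bullet> f2\<bar> \<le> 2 * E" "\<bar>v \<bullet> f3\<bar> \<le> 2 * E" and pos: "- (2 * E) \<le> v \<bullet> f1" for v
  proof -
    define c where "c = v \<bullet> f1"
    have "1 = c * c + (v \<bullet> f2)\<^sup>2 + (v \<bullet> f3)\<^sup>2" using expand[of v v] v by (simp add: c_def norm_eq_1 power2_eq_square)
    moreover have "(v \<bullet> f2)\<^sup>2 \<le> 4 * E\<^sup>2" "(v \<bullet> f3)\<^sup>2 \<le> 4 * E\<^sup>2"
      using power_mono[OF a(1) abs_ge_zero, of 2] power_mono[OF a(2) abs_ge_zero, of 2] by (simp_all add: power_mult_distrib)
    ultimately have cc: "1 - 8 * E\<^sup>2 \<le> c * c" by linarith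
    have "\<bar>c\<bar> \<le> 1" using abs_inner_le[OF eq_refl[OF v] eq_refl[OF f1(1)]] by (simp add: c_def)
    have "0 \<le> c"
    proof (rule ccontr)
      assume "\<not> 0 \<le> c"
      then have "\<bar>c\<bar> \<le> 2 * E" using pos by (simp add: c_def)
      then have "c * c \<le> 4 * E\<^sup>2" using power_mono[of "\<bar>c\<bar>" "2 * E" 2] by (simp add: power2_eq_square)
      then show False using cc E_powers E_small by linarith
    qed
    then have "c * c \<le> c" using \<open>\<bar>c\<bar> \<le> 1\<close> by (simp add: mult_left_le)
    have "(norm (v - f1))\<^sup>2 = 2 - 2 * c"
      unfolding power2_norm_eq_inner using v f1(1) by (simp add: inner_simps c_def norm_eq_1 inner_commute)
    also have "\<dots> \<le> (4 * E)\<^sup>2" using cc \<open>c * c \<le> c\<close> by (simp add: power_mult_distrib)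
    finally show ?thesis by (rule power2_le_imp_le) (use E_pos in simp)
  qed
  have x3': "norm (\<xi> 3 r - f1) \<le> 4 * E" for r
  proof (rule near)
    show "- (2 * E) \<le> \<xi> 3 r \<bullet> f1"
      using abs_inner_le[OF c2[of True r] eq_refl[OF f1(1)]] f1(4) E_pos by (simp add: inner_diff_left)
    show "\<bar>\<xi> 3 r \<bullet> f2\<bar> \<le> 2 * E" using xf2[of r] E_pos by linarith
  qed (simp_all add: unit_\<xi> xf3)
  have m2': "norm (m 2 r - f1) \<le> 4 * E" for r
  proof (rule near)
    have "norm (m 2 r - m 2 True) \<le> 2 * E"
      using norm_triangle_ineq4[of "m 2 r - \<xi> 3 True" "m 2 True - \<xi> 3 True"] c2[of r True] c2[of True True] by simp
    then show "- (2 * E) \<le> m 2 r \<bullet> f1"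
      using abs_inner_le[of "m 2 r - m 2 True" "2 * E" f1 1] f1 by (simp add: inner_diff_left)
    show "\<bar>m 2 r \<bullet> f3\<bar> \<le> 2 * E" using mf3[of r] E_pos by linarith
  qed (simp_all add: unit_m mf2)
  have f: "f 1 = f1" "f 2 = f2" "f 3 = f3" by (simp_all add: f_def)
  show ?thesis
  proof (rule that)
    fix a :: 3
    show "norm (f a) = 1" by (simp add: f_def u f1)
    show "f a \<bullet> f (a + 1) = 0"
      using exhaust_3[of a] by (elim disjE; simp only: three f) (simp_all add: u f1 inner_commute)
    show "v \<bullet> v' = (\<Sum>a\<in>UNIV. (v \<bullet> f a) * (v' \<bullet> f a))" for v v'
      unfolding sum_3 f by (rule expand)
    have weak: "c \<le> 4 * E" if "c \<le> E \<or> c \<le> 2 * E \<or> c \<le> 4 * E" for c using that E_pos by linarith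
    show "norm (\<xi> a s - f (a + 1)) \<le> 4 * E" for s
      using exhaust_3[of a] by (elim disjE; simp only: three f; intro weak) (simp_all add: x1 x2 x3')
    show "norm (m a s - f (a + 2)) \<le> 4 * E" for s
      using exhaust_3[of a] by (elim disjE; simp only: three f; intro weak) (simp_all add: m1 m2' m3)
  qed
qed

context
  fixes f :: "3 \<Rightarrow> real^3"
  assumes unit_f: "\<And>a. norm (f a) = 1" and orth_f: "\<And>a. f a \<bullet> f (a + 1) = 0"
    and expand_f: "\<And>u v. u \<bullet> v = (\<Sum>a\<in>UNIV. (u \<bullet> f a) * (v \<bullet> f a))"
    and \<xi>_near: "\<And>a s. norm (\<xi> a s - f (a + 1)) \<le> 4 * E"
    and m_near: "\<And>a s. norm (m a s - f (a + 2)) \<le> 4 * E"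
begin

text \<open>To first order, \<open>p a\<close> is the relative angle of the two lines with index \<open>a\<close> about their common
  normal \<open>f a\<close>. The next lemmas show that all other components of \<open>\<delta>\<xi> a\<close> and \<open>\<delta>m a\<close> are of
  second order.\<close>

definition p where "p a = \<delta>\<xi> a \<bullet> f (a + 2)"

lemma inner_expand:
  "u \<bullet> v = (u \<bullet> f a) * (v \<bullet> f a) + (u \<bullet> f (a + 1)) * (v \<bullet> f (a + 1))
    + (u \<bullet> f (a + 2)) * (v \<bullet> f (a + 2))"
proof -
  have four: "(4::3) = 1" "(5::3) = 2" by simp_all
  show ?thesis
    using exhaust_3[of a] by (auto simp: expand_f[of u v] sum_3 four)
qed

lemma near:
  "\<bar>\<delta>\<xi> b \<bullet> (f (a + 1) - \<xi> a s)\<bar> \<le> 8 * E\<^sup>2" "\<bar>\<delta>m b \<bullet> (f (a + 1) - \<xi> a s)\<bar> \<le> 8 * E\<^sup>2"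
  "\<bar>\<delta>\<xi> b \<bullet> (f (a + 2) - m a s)\<bar> \<le> 8 * E\<^sup>2" "\<bar>\<delta>m b \<bullet> (f (a + 2) - m a s)\<bar> \<le> 8 * E\<^sup>2"
  using abs_inner_le[OF norm_\<delta>\<xi>[of b] \<xi>_near[of a s, unfolded norm_minus_commute[of "\<xi> a s"]]]
   abs_inner_le[OF norm_\<delta>m[of b] \<xi>_near[of a s, unfolded norm_minus_commute[of "\<xi> a s"]]]
   abs_inner_le[OF norm_\<delta>\<xi>[of b] m_near[of a s, unfolded norm_minus_commute[of "m a s"]]]
   abs_inner_le[OF norm_\<delta>m[of b] m_near[of a s, unfolded norm_minus_commute[of "m a s"]]]
  by (simp_all add: power2_eq_square)

text \<open>A difference of unit vectors is orthogonal to their sum, and the sum is nearly twice \<open>f (a + 1)\<close>.\<close>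

lemma \<delta>\<xi>_own: "\<bar>\<delta>\<xi> a \<bullet> f (a + 1)\<bar> \<le> 8 * E\<^sup>2"
proof -
  have "\<delta>\<xi> a \<bullet> (\<xi> a True + \<xi> a False) = 0"
    by (simp add: \<delta>\<xi>_def inner_simps inner_self inner_commute)
  then have "2 * (\<delta>\<xi> a \<bullet> f (a + 1)) = \<delta>\<xi> a \<bullet> (f (a + 1) - \<xi> a True) + \<delta>\<xi> a \<bullet> (f (a + 1) - \<xi> a False)"
    by (simp add: inner_diff_right inner_add_right)
  then show ?thesis using near(1)[of a a True] near(1)[of a a False] by linarith
qed

lemma \<delta>m_own: "\<bar>\<delta>m a \<bullet> f (a + 2)\<bar> \<le> 8 * E\<^sup>2"
proof -
  have "\<delta>m a \<bullet> (m a True + m a False) = 0"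
    by (simp add: \<delta>m_def inner_simps inner_self inner_commute)
  then have "2 * (\<delta>m a \<bullet> f (a + 2)) = \<delta>m a \<bullet> (f (a + 2) - m a True) + \<delta>m a \<bullet> (f (a + 2) - m a False)"
    by (simp add: inner_diff_right inner_add_right)
  then show ?thesis using near(4)[of a a True] near(4)[of a a False] by linarith
qed

text \<open>Up to second order, \<open>f a\<close> may be replaced by \<open>m (a + 1) True\<close>, and the inner product with the
  latter is a difference of two values of \<open>w\<close>.\<close>

lemma \<delta>\<xi>_radial: "\<bar>\<delta>\<xi> a \<bullet> f a\<bar> \<le> 18 * E\<^sup>2"
proof -
  have "\<delta>\<xi> a \<bullet> f a = w a True True - w a False True + \<delta>\<xi> a \<bullet> (f a - m (a + 1) True)"
    by (simp add: \<delta>\<xi>_def w_def inner_simps)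
  then show ?thesis
    using w_fine[of a True True] w_fine[of a False True] near(3)[of a "a + 1" True] by (simp add: cyclic_add_3)
qed

lemma \<delta>m_radial: "\<bar>\<delta>m (a + 1) \<bullet> f (a + 1)\<bar> \<le> 18 * E\<^sup>2"
proof -
  have "\<delta>m (a + 1) \<bullet> f (a + 1) = w a True True - w a True False + \<delta>m (a + 1) \<bullet> (f (a + 1) - \<xi> a True)"
    by (simp add: \<delta>m_def w_def inner_simps inner_commute)
  then show ?thesis
    using w_fine[of a True True] w_fine[of a True False] near(2)[of "a + 1" a True] by linarith
qed

text \<open>The orthogonality of \<open>\<xi> a s\<close> and \<open>m a s\<close> on both sides \<open>s\<close> forces direction and moment to
  rotate by the same angle.\<close>

lemma \<delta>m_p: "\<bar>\<delta>m a \<bullet> f (a + 1) + p a\<bar> \<le> 16 * E\<^sup>2"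
proof -
  have "\<delta>m a \<bullet> \<xi> a True + \<delta>\<xi> a \<bullet> m a False = 0"
    by (simp add: \<delta>m_def \<delta>\<xi>_def inner_simps orth orth' inner_commute)
  then have "\<delta>m a \<bullet> f (a + 1) + p a = \<delta>m a \<bullet> (f (a + 1) - \<xi> a True) + \<delta>\<xi> a \<bullet> (f (a + 2) - m a False)"
    by (simp add: p_def inner_diff_right)
  then show ?thesis using near(2)[of a a True] near(3)[of a a False] by linarith
qed

lemma p_coarse: "\<bar>p a\<bar> \<le> 2 * E"
  using abs_inner_le[OF norm_\<delta>\<xi>[of a] order_refl, of "f (a + 2)"] by (simp add: p_def unit_f)

lemma K_p: "\<bar>K a + p a * p (a + 1)\<bar> \<le> 33 * E ^ 3"
proof -
  define x where "x = (\<delta>\<xi> a \<bullet> f a) * (\<delta>m (a + 1) \<bullet> f a)"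
  define y where "y = (\<delta>\<xi> a \<bullet> f (a + 1)) * (\<delta>m (a + 1) \<bullet> f (a + 1))"
  define z where "z = p a * (\<delta>m (a + 1) \<bullet> f (a + 2) + p (a + 1))"
  have "K a + p a * p (a + 1) = x + y + z"
    using inner_expand[of "\<delta>\<xi> a" "\<delta>m (a + 1)" a]
    unfolding K_def[symmetric] x_def[symmetric] y_def[symmetric] z_def distrib_left p_def[of a] by linarith
  moreover have "\<bar>x\<bar> \<le> 18 * E\<^sup>2 * (8 * E\<^sup>2)"
    unfolding x_def abs_mult using \<delta>\<xi>_radial[of a] \<delta>m_own[of "a + 1"] by (intro mult_mono) (simp_all add: cyclic_add_3)
  moreover have "\<bar>y\<bar> \<le> 8 * E\<^sup>2 * (18 * E\<^sup>2)"
    unfolding y_def abs_mult using \<delta>\<xi>_own[of a] \<delta>m_radial[of a] by (intro mult_mono) simp_all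
  moreover have "\<bar>z\<bar> \<le> 2 * E * (16 * E\<^sup>2)"
    unfolding z_def abs_mult using p_coarse[of a] \<delta>m_p[of "a + 1"] E_pos by (intro mult_mono) (simp_all add: cyclic_add_3)
  moreover have "18 * E\<^sup>2 * (8 * E\<^sup>2) = 144 * E ^ 4" "8 * E\<^sup>2 * (18 * E\<^sup>2) = 144 * E ^ 4"
    "2 * E * (16 * E\<^sup>2) = 32 * E ^ 3" by (simp_all add: eval_nat_numeral)
  ultimately show ?thesis using E_powers(1,5) by linarith
qed

text \<open>The vectors \<open>m a s - \<xi> (a + 1) t\<close> for the two values of \<open>t\<close> have \<open>f a\<close>-components that differ by
  \<open>p (a + 1)\<close>, so they cannot both be small; and \<open>f a\<close> is nearly orthogonal to \<open>\<xi> a s\<close>, so the residual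
  sees this component.\<close>

lemma p_le_res: "(p (a + 1))\<^sup>2 \<le> 2 * ((norm (res a s True))\<^sup>2 + (norm (res a s False))\<^sup>2) + 32 * E ^ 3"
proof -
  define g where "g t = (m a s - \<xi> (a + 1) t) \<bullet> f a" for t
  have g: "\<bar>g t\<bar> \<le> norm (res a s t) + 4 * E\<^sup>2" for t
  proof -
    have "\<xi> a s \<bullet> f a = (\<xi> a s - f (a + 1)) \<bullet> f a"
      using orth_f[of a] by (simp add: inner_diff_left inner_commute[of "f (a + 1)"])
    then have "\<bar>\<xi> a s \<bullet> f a\<bar> \<le> 4 * E"
      using abs_inner_le[OF \<xi>_near[of a s] order_refl, of "f a"] by (simp add: unit_f)
    then have "\<bar>Q a s t * (\<xi> a s \<bullet> f a)\<bar> \<le> E * (4 * E)"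
      unfolding abs_mult using Q_coarse[of a s t] E_pos by (intro mult_mono) simp_all
    moreover have "g t = res a s t \<bullet> f a - Q a s t * (\<xi> a s \<bullet> f a)"
      by (simp add: g_def res_def inner_simps)
    moreover have "\<bar>res a s t \<bullet> f a\<bar> \<le> norm (res a s t)"
      using abs_inner_le[OF order_refl order_refl, of "res a s t" "f a"] by (simp add: unit_f)
    ultimately show ?thesis by (simp add: power2_eq_square)
  qed
  define x where "x = norm (res a s True)"
  define y where "y = norm (res a s False)"
  define z where "z = \<bar>p (a + 1)\<bar>"
  have "p (a + 1) = g False - g True"
    by (simp add: p_def g_def \<delta>\<xi>_def inner_simps cyclic_add_3)
  then have z: "z \<le> x + y + 8 * E\<^sup>2" using g[of True] g[of False] unfolding x_def y_def z_def by linarith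
  \<comment> \<open>Squaring \<open>z - 8 * E\<^sup>2 \<le> x + y\<close> needs the left-hand side to be nonnegative.\<close>
  have "z\<^sup>2 - 16 * E\<^sup>2 * z \<le> 2 * (x\<^sup>2 + y\<^sup>2)"
  proof (cases "8 * E\<^sup>2 \<le> z")
    case True
    have "(z - 8 * E\<^sup>2)\<^sup>2 \<le> (x + y)\<^sup>2" using z True by (intro power_mono) auto
    moreover have "(x + y)\<^sup>2 \<le> 2 * (x\<^sup>2 + y\<^sup>2)" using zero_le_power2[of "x - y"]
      by (simp add: power2_eq_square algebra_simps)
    moreover have "z\<^sup>2 - 16 * E\<^sup>2 * z \<le> (z - 8 * E\<^sup>2)\<^sup>2" using zero_le_power2[of "8 * E\<^sup>2"]
      by (simp add: power2_eq_square algebra_simps)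
    ultimately show ?thesis by linarith
  next
    case False
    then have "z * z \<le> 16 * E\<^sup>2 * z" by (intro mult_right_mono) (auto simp: z_def)
    then have "z\<^sup>2 \<le> 16 * E\<^sup>2 * z" by (simp add: power2_eq_square)
    moreover have "0 \<le> 2 * (x\<^sup>2 + y\<^sup>2)" by simp
    ultimately show ?thesis by linarith
  qed
  moreover have "16 * E\<^sup>2 * z \<le> 16 * E\<^sup>2 * (2 * E)" using p_coarse[of "a + 1"] by (intro mult_left_mono) (auto simp: z_def)
  moreover have "E\<^sup>2 * E = E ^ 3" by (simp add: eval_nat_numeral)
  ultimately show ?thesis by (simp add: x_def y_def z_def)
qed

lemma p_quadratic: "(p (a + 1))\<^sup>2 \<le> - 2 * (p a * p (a + 1)) + 100 * E ^ 3"
proof -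
  have "2 * (p (a + 1))\<^sup>2 \<le> 2 * (\<Sum>s\<in>UNIV. \<Sum>t\<in>UNIV. (norm (res a s t))\<^sup>2) + 64 * E ^ 3"
    using p_le_res[of a True] p_le_res[of a False] by (simp add: UNIV_bool)
  then show ?thesis using sum_res_le[of a] K_p[of a] E_powers(1,5) by linarith
qed

lemma K_fine_aux: "K a \<le> 2133 * E ^ 3"
proof -
  have "\<bar>p a * p (a + 1)\<bar> \<le> 21 * (100 * E ^ 3)"
    using cyclic_quadratic_bound[of "100 * E ^ 3" "p (a + 1)" "p a" "p (a + 2)"]
      p_quadratic[of a] p_quadratic[of "a + 1"] p_quadratic[of "a + 2"] E_powers by (simp add: cyclic_add_3)
  then show ?thesis using K_p[of a] by linarith
qed

end

lemma K_fine: "K a \<le> 2133 * E ^ 3"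
proof -
  obtain f :: "3 \<Rightarrow> real^3" where f:
    "\<And>a. norm (f a) = 1" "\<And>a. f a \<bullet> f (a + 1) = 0"
    "\<And>u v. u \<bullet> v = (\<Sum>a\<in>UNIV. (u \<bullet> f a) * (v \<bullet> f a))"
    "\<And>a s. norm (\<xi> a s - f (a + 1)) \<le> 4 * E" "\<And>a s. norm (m a s - f (a + 2)) \<le> 4 * E"
    using exists_frame by blast
  show ?thesis by (rule K_fine_aux[OF f])
qed

lemma res_fine: "(norm (res a s t))\<^sup>2 \<le> 4267 * E ^ 3"
  using res_le[of a s t] K_fine[of a] E_powers by linarith

text \<open>The residuals leave open the component of \<open>m a s - \<xi> (a + 1) t\<close> along \<open>\<xi> a s\<close>, which is \<open>- Q a s t\<close>.
  Replacing \<open>\<xi> a s\<close> by \<open>m (a + 2) True\<close> in \<open>Q a s t\<close> gives a value of \<open>w\<close>, and the error is controlled by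
  the residual with index \<open>a + 2\<close>: its component along \<open>\<xi> (a + 2) True\<close> is almost orthogonal to
  \<open>\<xi> (a + 1) t\<close>.\<close>

lemma Q_fine: "(Q a s t)\<^sup>2 \<le> 8600 * E ^ 3"
proof -
  define n where "n = norm (res (a + 2) True s)"
  have "Q a s t = w (a + 1) t True - res (a + 2) True s \<bullet> \<xi> (a + 1) t + Q (a + 2) True s * Q (a + 1) t True"
    by (simp add: Q_def w_def res_def inner_simps cyclic_add_3 inner_commute)
  moreover have "\<bar>res (a + 2) True s \<bullet> \<xi> (a + 1) t\<bar> \<le> n * 1"
    unfolding n_def by (intro abs_inner_le) (simp_all add: unit_\<xi>)
  moreover have "\<bar>Q (a + 2) True s * Q (a + 1) t True\<bar> \<le> E * E"
    unfolding abs_mult using Q_coarse E_pos by (intro mult_mono) auto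
  ultimately have "\<bar>Q a s t\<bar> \<le> n + 6 * E\<^sup>2" using w_fine[of "a + 1" t True] by (simp add: power2_eq_square)
  then have "\<bar>Q a s t\<bar>\<^sup>2 \<le> (n + 6 * E\<^sup>2)\<^sup>2" by (rule power_mono) simp
  also have "\<dots> \<le> 2 * n\<^sup>2 + 2 * (6 * E\<^sup>2)\<^sup>2" using zero_le_power2[of "n - 6 * E\<^sup>2"]
    by (simp add: power2_eq_square algebra_simps)
  also have "(6 * E\<^sup>2)\<^sup>2 = 36 * E ^ 4" by (simp add: eval_nat_numeral)
  finally show ?thesis using res_fine[of "a + 2" True s] E_powers unfolding n_def[symmetric] unfolding power2_abs by linarith
qed

theorem closeness_improves: "(norm (m a s - \<xi> (a + 1) t))\<^sup>2 \<le> E\<^sup>2 / 4"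
  unfolding norm_res using res_fine[of a s t] Q_fine[of a s t] E_powers by linarith

end

section \<open>From tangent lines to signed frames\<close>

text \<open>For lines that are not parallel, the closest points differ by a multiple of the common normal
  \<open>\<xi> \<times> \<eta>\<close>, whose squared length is \<open>1 - (\<xi> \<bullet> \<eta>)\<^sup>2\<close>. The inner product of \<open>x - y\<close> with this normal is
  the sum of the two mixed products. For parallel lines the second summand alone is \<open>1\<close>.\<close>

lemma tangent_lines_separation:
  assumes xy: "(x, \<xi>) \<in> unit_tangents" "(y, \<eta>) \<in> unit_tangents"
    and dist: "1 \<le> setdist (line x \<xi>) (line y \<eta>)"
  shows "1 \<le> (cross3 x \<xi> \<bullet> \<eta> + \<xi> \<bullet> cross3 y \<eta>)\<^sup>2 + (\<xi> \<bullet> \<eta>)\<^sup>2"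
proof (cases "(\<xi> \<bullet> \<eta>)\<^sup>2 < 1")
  case True
  have u: "\<xi> \<bullet> \<xi> = 1" "\<eta> \<bullet> \<eta> = 1" "norm \<xi> = 1" "norm \<eta> = 1" using xy by (auto simp: unit_tangents_def norm_eq_1)
  define q where "q = \<xi> \<bullet> \<eta>"
  define D where "D = 1 - q\<^sup>2"
  define n where "n = cross3 \<xi> \<eta>"
  have D: "0 < D" using True by (simp add: D_def q_def)
  have n: "(norm n)\<^sup>2 = D" "n \<bullet> \<xi> = 0" "n \<bullet> \<eta> = 0" 
    using norm_cross[of \<xi> \<eta>] u by (simp_all add: n_def D_def q_def dot_cross_self)
  define z where "z = x - y"
  \<comment> \<open>The parameters \<open>t\<close> and \<open>s\<close> of the closest points solve the linear system \<open>v \<bullet> \<xi> = v \<bullet> \<eta> = 0\<close>.\<close>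
  define s where "s = (z \<bullet> \<eta> - q * (z \<bullet> \<xi>)) / D"
  define t where "t = s * q - z \<bullet> \<xi>"
  define v where "v = z + t *\<^sub>R \<xi> - s *\<^sub>R \<eta>"
  have "s * D = z \<bullet> \<eta> - q * (z \<bullet> \<xi>)" using D by (simp add: s_def)
  then have sD: "s - s * q * q = z \<bullet> \<eta> - q * (z \<bullet> \<xi>)" by (simp add: D_def algebra_simps power2_eq_square)
  have "v \<bullet> \<xi> = 0" by (simp add: v_def t_def inner_simps u q_def inner_commute[of \<eta> \<xi>])
  moreover have "v \<bullet> \<eta> = 0"
    using sD by (simp add: v_def t_def inner_simps u flip: q_def) (simp add: algebra_simps)
  ultimately have "cross3 v n = 0" by (simp add: n_def Lagrange)
  then have "(v \<bullet> n)\<^sup>2 = (norm v)\<^sup>2 * D"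
    using norm_cross_dot[of v n] n(1) by (simp add: power_mult_distrib)
  moreover have "1 \<le> norm v"
  proof -
    have "x + t *\<^sub>R \<xi> \<in> line x \<xi>" "y + s *\<^sub>R \<eta> \<in> line y \<eta>" by (auto simp: line_def)
    then have "1 \<le> dist (x + t *\<^sub>R \<xi>) (y + s *\<^sub>R \<eta>)" using dist setdist_le_dist order_trans by blast
    then show ?thesis by (simp add: dist_norm v_def z_def algebra_simps)
  qed
  then have "1 * D \<le> (norm v)\<^sup>2 * D" using D by (intro mult_right_mono) auto
  moreover have "v \<bullet> n = z \<bullet> n" using n by (simp add: v_def inner_simps inner_commute)
  moreover have "z \<bullet> n = cross3 x \<xi> \<bullet> \<eta> + \<xi> \<bullet> cross3 y \<eta>"
    by (simp add: z_def n_def cross3_simps)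
  ultimately show ?thesis by (simp add: D_def q_def)
next
  case False
  then show ?thesis by (simp add: add_increasing)
qed

lemma norm_diff_unit:
  assumes "norm u = 1" "norm v = 1"
  shows "(norm (u - v))\<^sup>2 = 2 - 2 * (u \<bullet> v)"
  using assms unfolding power2_norm_eq_inner by (simp add: inner_simps norm_eq_1 inner_commute)

lemma norm_diff_unit_le:
  assumes "norm u = 1" "norm v = 1" "0 \<le> u \<bullet> v" "1 - E\<^sup>2 / 2 < (u \<bullet> v)\<^sup>2" "0 < E"
  shows "norm (u - v) \<le> E"
proof (rule power2_le_imp_le)
  have "\<bar>u \<bullet> v\<bar> \<le> 1" using Cauchy_Schwarz_ineq2[of u v] assms by simp
  then have "(u \<bullet> v)\<^sup>2 \<le> u \<bullet> v" using assms(3) by (simp add: power2_eq_square mult_left_le)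
  then show "(norm (u - v))\<^sup>2 \<le> E\<^sup>2" unfolding norm_diff_unit[OF assms(1,2)] using assms(4) by linarith
qed (use assms in simp)

text \<open>Signs are propagated from \<open>v True\<close> to both \<open>u s\<close> and from \<open>u True\<close> to \<open>v False\<close>. The remaining
  pair is then consistent by the triangle inequality.\<close>

lemma exists_signs:
  fixes u v :: "bool \<Rightarrow> 'a::real_inner"
  assumes unit: "\<And>s. norm (u s) = 1" "\<And>t. norm (v t) = 1"
    and E: "0 < E" "E \<le> 1/3"
    and big: "\<And>s t. 1 - E\<^sup>2 / 2 < (u s \<bullet> v t)\<^sup>2"
  obtains \<alpha> \<beta> :: "bool \<Rightarrow> real" where "\<And>s. \<alpha> s \<in> {1, -1}" "\<And>t. \<beta> t \<in> {1, -1}"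
    "\<And>s t. norm (\<alpha> s *\<^sub>R u s - \<beta> t *\<^sub>R v t) \<le> E"
proof -
  define \<alpha> :: "bool \<Rightarrow> real" where "\<alpha> s = (if 0 \<le> u s \<bullet> v True then 1 else -1)" for s
  define \<beta> :: "bool \<Rightarrow> real" where "\<beta> t = (if t \<or> 0 \<le> \<alpha> True * (u True \<bullet> v t) then 1 else -1)" for t
  have sgn: "\<alpha> s \<in> {1, -1}" "\<beta> t \<in> {1, -1}" for s t by (auto simp: \<alpha>_def \<beta>_def)
  have sq: "(\<alpha> s)\<^sup>2 = 1" "(\<beta> t)\<^sup>2 = 1" "\<bar>\<alpha> s\<bar> = 1" "\<bar>\<beta> t\<bar> = 1" for s t using sgn(1)[of s] sgn(2)[of t] by auto
  have close: "norm (\<alpha> s *\<^sub>R u s - \<beta> t *\<^sub>R v t) \<le> E" if "0 \<le> (\<alpha> s *\<^sub>R u s) \<bullet> (\<beta> t *\<^sub>R v t)" for s t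
    using that big[of s t] E by (intro norm_diff_unit_le) (simp_all add: unit sq power_mult_distrib)
  have c1: "norm (\<alpha> s *\<^sub>R u s - \<beta> True *\<^sub>R v True) \<le> E" for s
    by (rule close) (simp add: \<alpha>_def \<beta>_def)
  have c2: "norm (\<alpha> True *\<^sub>R u True - \<beta> False *\<^sub>R v False) \<le> E"
    by (rule close) (simp add: \<beta>_def)
  have c3: "norm (\<alpha> False *\<^sub>R u False - \<beta> False *\<^sub>R v False) \<le> E"
  proof (rule close)
    define a where "a = \<alpha> False *\<^sub>R u False"
    define b where "b = \<beta> False *\<^sub>R v False"
    have "norm (a - b) \<le> 3 * E"
      using norm_triangle_ineq4[of "a - \<beta> True *\<^sub>R v True" "\<alpha> True *\<^sub>R u True - \<beta> True *\<^sub>R v True"]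
        norm_triangle_ineq[of "a - \<alpha> True *\<^sub>R u True" "\<alpha> True *\<^sub>R u True - b"] c1[of True] c1[of False] c2
      by (simp add: a_def b_def)
    then have "(norm (a - b))\<^sup>2 \<le> 1\<^sup>2" using E by (intro power_mono) auto
    moreover have "(norm (a - b))\<^sup>2 = 2 - 2 * (a \<bullet> b)"
      by (intro norm_diff_unit) (simp_all add: a_def b_def unit sq)
    ultimately show "0 \<le> a \<bullet> b" by simp
  qed
  have "norm (\<alpha> s *\<^sub>R u s - \<beta> t *\<^sub>R v t) \<le> E" for s t
    using c1[of s] c2 c3 by (cases s; cases t) simp_all
  then show thesis using that[of \<alpha> \<beta>] sgn by blast
qed

lemma norm_cross_le: "norm (cross3 x y) \<le> norm x * norm y"
proof (rule power2_le_imp_le)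
  show "(norm (cross3 x y))\<^sup>2 \<le> (norm x * norm y)\<^sup>2"
    unfolding norm_cross power_mult_distrib by simp
qed simp

text \<open>Adjusting signs brings the six lines into the situation of \<open>octahedral_frames\<close>. Two things have
  to be checked. The hypothesis \<open>near\<close> is blind to orientation, so the two lines with index \<open>a\<close> could
  a priori have the same orientation \<open>\<sigma>\<close>; but then they would nearly coincide. And the sides may have
  to be swapped for the side \<open>True\<close> to be the one with positive orientation.\<close>

lemma octahedral_gap:
  fixes x \<xi> :: "3 \<Rightarrow> bool \<Rightarrow> real^3" and E :: real
  defines "m \<equiv> \<lambda>a s. cross3 (x a s) (\<xi> a s)"
  assumes tangent: "\<And>a s. (x a s, \<xi> a s) \<in> unit_tangents"
    and sep: "\<And>a s b t. (a, s) \<noteq> (b, t) \<Longrightarrow> 1 \<le> setdist (line (x a s) (\<xi> a s)) (line (x b t) (\<xi> b t))"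
    and E: "0 < E" "E \<le> 1/100000"
    and near: "\<And>a s t. 1 - E\<^sup>2 / 2 < (m a s \<bullet> \<xi> (a + 1) t)\<^sup>2"
  shows "1 - E\<^sup>2 / 4 \<le> (m a s \<bullet> \<xi> (a + 1) t)\<^sup>2"
proof -
  have ux: "norm (x a s) = 1" and u\<xi>: "norm (\<xi> a s) = 1" and x\<xi>: "x a s \<bullet> \<xi> a s = 0" for a s
    using tangent[of a s] by (auto simp: unit_tangents_def)
  have \<xi>m: "\<xi> a s \<bullet> m a s = 0" for a s by (simp add: m_def dot_cross_self)
  have "(norm (m a s))\<^sup>2 = 1\<^sup>2" for a s by (simp add: m_def norm_cross ux u\<xi> x\<xi>)
  then have um: "norm (m a s) = 1" for a s
    using power2_eq_iff_nonneg[of "norm (m a s)" 1] by simp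
  have xm: "cross3 (\<xi> a s) (m a s) = x a s" for a s
    unfolding m_def Lagrange using u\<xi>[of a s] x\<xi>[of a s] by (simp add: norm_eq_1 inner_commute)
  have "\<exists>\<alpha> \<beta> :: bool \<Rightarrow> real. (\<forall>s. \<alpha> s \<in> {1, -1}) \<and> (\<forall>t. \<beta> t \<in> {1, -1}) \<and>
      (\<forall>s t. norm (\<alpha> s *\<^sub>R m a s - \<beta> t *\<^sub>R \<xi> (a + 1) t) \<le> E)" for a
    by (rule exists_signs[of "m a" "\<xi> (a + 1)" E]) (use um u\<xi> E near in \<open>auto\<close>)
  then obtain \<zeta> \<beta> :: "3 \<Rightarrow> bool \<Rightarrow> real" where \<zeta>: "\<And>a s. \<zeta> a s \<in> {1, -1}" and \<beta>: "\<And>a s. \<beta> a s \<in> {1, -1}"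
    and close: "\<And>a s t. norm (\<zeta> a s *\<^sub>R m a s - \<beta> a t *\<^sub>R \<xi> (a + 1) t) \<le> E"
    by metis
  \<comment> \<open>The sign \<open>\<beta> a\<close> belongs to the directions with index \<open>a + 1\<close>.\<close>
  define \<epsilon> where "\<epsilon> a = \<beta> (a + 2)" for a
  have \<epsilon>: "\<epsilon> a s \<in> {1, -1}" for a s by (simp add: \<epsilon>_def \<beta> del: insert_iff)
  have abs: "\<bar>\<zeta> a s\<bar> = 1" "\<bar>\<epsilon> a s\<bar> = 1" for a s using \<zeta>[of a s] \<epsilon>[of a s] by auto
  have sq: "\<zeta> a s * \<zeta> a s = 1" "\<epsilon> a s * \<epsilon> a s = 1" for a s using \<zeta>[of a s] \<epsilon>[of a s] by auto
  define X where "X a s = \<epsilon> a s *\<^sub>R \<xi> a s" for a s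
  define M where "M a s = \<zeta> a s *\<^sub>R m a s" for a s
  define \<sigma> where "\<sigma> a s = \<zeta> a s * \<epsilon> a s" for a s
  have \<sigma>: "\<sigma> a s \<in> {1, -1}" for a s using \<zeta>[of a s] \<epsilon>[of a s] by (auto simp: \<sigma>_def)
  have close': "norm (M a s - X (a + 1) t) \<le> E" for a s t
    using close[of a s t] by (simp add: M_def X_def \<epsilon>_def cyclic_add_3)
  have uX: "norm (X a s) = 1" and uM: "norm (M a s) = 1" for a s
    by (simp_all add: X_def M_def abs u\<xi> um)
  have XM: "cross3 (X a s) (M a s) = \<sigma> a s *\<^sub>R x a s" for a s
    by (simp add: X_def M_def \<sigma>_def cross_mult_left cross_mult_right xm)
  have opposite: "\<sigma> a True \<noteq> \<sigma> a False" for a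
  proof
    assume eq: "\<sigma> a True = \<sigma> a False"
    have dX: "norm (X a True - X a False) \<le> 2 * E"
      using norm_triangle_ineq4[of "M (a + 2) True - X a False" "M (a + 2) True - X a True"]
        close'[of "a + 2" True True] close'[of "a + 2" True False] by (simp add: cyclic_add_3)
    have dM: "norm (M a True - M a False) \<le> 2 * E"
      using norm_triangle_ineq4[of "M a True - X (a + 1) True" "M a False - X (a + 1) True"]
        close'[of a True True] close'[of a False True] by simp
    have "\<sigma> a True *\<^sub>R (x a True - x a False) = cross3 (X a True - X a False) (M a True) + cross3 (X a False) (M a True - M a False)"
      unfolding Cross3.left_diff_distrib Cross3.right_diff_distrib XM using eq by (simp add: algebra_simps)
    then have "norm (x a True - x a False) = norm (cross3 (X a True - X a False) (M a True) + cross3 (X a False) (M a True - M a False))"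
      using \<sigma>[of a True] by (metis insertE abs_minus_cancel abs_one empty_iff mult_1 norm_scaleR)
    also have "\<dots> \<le> norm (X a True - X a False) * norm (M a True) + norm (X a False) * norm (M a True - M a False)"
      by (intro order_trans[OF norm_triangle_ineq] add_mono norm_cross_le)
    also have "\<dots> \<le> 4 * E" using dX dM by (simp add: uX uM)
    finally have "dist (x a True) (x a False) \<le> 4 * E" by (simp add: dist_norm)
    moreover have "x a s \<in> line (x a s) (\<xi> a s)" for s by (auto simp: line_def intro: range_eqI[of _ _ 0])
    then have "setdist (line (x a True) (\<xi> a True)) (line (x a False) (\<xi> a False)) \<le> dist (x a True) (x a False)"
      by (intro setdist_le_dist)
    then have "1 \<le> dist (x a True) (x a False)" using sep[of a True a False] by simp
    ultimately show False using E by linarith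
  qed
  \<comment> \<open>The side \<open>s\<close> of positively oriented lines is renamed \<open>True\<close>: \<open>s \<mapsto> (s = k a)\<close> is the identity or
    the swap, and its own inverse.\<close>
  define k where "k a \<longleftrightarrow> \<sigma> a True = 1" for a
  have \<sigma>k: "\<sigma> a (s = k a) = sg s" for a s
    using \<sigma>[of a True] \<sigma>[of a False] opposite[of a] by (cases "k a"; cases s) (auto simp: sg_def k_def)
  have "octahedral_frames (\<lambda>a s. X a (s = k a)) (\<lambda>a s. M a (s = k a)) E"
  proof
    fix a :: 3 and s t :: bool
    have ne: "(a, s') \<noteq> (a + 1, t')" for s' t' using exhaust_3[of a] by auto
    have "1 \<le> (m a s' \<bullet> \<xi> (a + 1) t' + \<xi> a s' \<bullet> m (a + 1) t')\<^sup>2 + (\<xi> a s' \<bullet> \<xi> (a + 1) t')\<^sup>2" for s' t'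
      using tangent_lines_separation[OF tangent tangent sep[OF ne]] by (simp add: m_def)
    moreover have "(X a s' \<bullet> X (a + 1) t')\<^sup>2 = (\<xi> a s' \<bullet> \<xi> (a + 1) t')\<^sup>2" for s' t'
      using \<epsilon>[of a s'] \<epsilon>[of "a + 1" t'] by (auto simp: X_def)
    moreover have "(M a s' \<bullet> X (a + 1) t' + \<sigma> a s' * \<sigma> (a + 1) t' * (X a s' \<bullet> M (a + 1) t'))\<^sup>2
        = (m a s' \<bullet> \<xi> (a + 1) t' + \<xi> a s' \<bullet> m (a + 1) t')\<^sup>2" for s' t'
    proof -
      have "M a s' \<bullet> X (a + 1) t' + \<sigma> a s' * \<sigma> (a + 1) t' * (X a s' \<bullet> M (a + 1) t')
        = \<zeta> a s' * \<epsilon> (a + 1) t' * (m a s' \<bullet> \<xi> (a + 1) t')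
          + (\<epsilon> a s' * \<epsilon> a s') * (\<zeta> (a + 1) t' * \<zeta> (a + 1) t') * (\<zeta> a s' * \<epsilon> (a + 1) t' * (\<xi> a s' \<bullet> m (a + 1) t'))"
        by (simp add: M_def X_def \<sigma>_def)
      also have "\<dots> = \<zeta> a s' * \<epsilon> (a + 1) t' * (m a s' \<bullet> \<xi> (a + 1) t' + \<xi> a s' \<bullet> m (a + 1) t')"
        unfolding sq by (simp add: distrib_left)
      finally have eq: "M a s' \<bullet> X (a + 1) t' + \<sigma> a s' * \<sigma> (a + 1) t' * (X a s' \<bullet> M (a + 1) t')
        = \<zeta> a s' * \<epsilon> (a + 1) t' * (m a s' \<bullet> \<xi> (a + 1) t' + \<xi> a s' \<bullet> m (a + 1) t')" .
      have "(\<zeta> a s' * \<epsilon> (a + 1) t')\<^sup>2 = 1" using \<zeta>[of a s'] \<epsilon>[of "a + 1" t'] by auto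
      then show ?thesis unfolding eq power_mult_distrib[of "\<zeta> a s' * \<epsilon> (a + 1) t'"] by simp
    qed
    ultimately have "1 \<le> (M a s' \<bullet> X (a + 1) t' + \<sigma> a s' * \<sigma> (a + 1) t' * (X a s' \<bullet> M (a + 1) t'))\<^sup>2
        + (X a s' \<bullet> X (a + 1) t')\<^sup>2" for s' t' by simp
    from this[of "s = k a" "t = k (a + 1)"]
    show "1 \<le> (M a (s = k a) \<bullet> X (a + 1) (t = k (a + 1))
      + sg s * sg t * (X a (s = k a) \<bullet> M (a + 1) (t = k (a + 1))))\<^sup>2 + (X a (s = k a) \<bullet> X (a + 1) (t = k (a + 1)))\<^sup>2"
      unfolding \<sigma>k .
  qed (use E close' uX uM \<xi>m in \<open>auto simp: X_def M_def\<close>)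
  then have "(norm (M a ((s = k a) = k a) - X (a + 1) ((t = k (a + 1)) = k (a + 1))))\<^sup>2 \<le> E\<^sup>2 / 4"
    by (rule octahedral_frames.closeness_improves)
  moreover have "((b = c) = c) = b" for b c by blast
  ultimately have "(norm (M a s - X (a + 1) t))\<^sup>2 \<le> E\<^sup>2 / 4" by simp
  then have "1 - E\<^sup>2 / 8 \<le> M a s \<bullet> X (a + 1) t" unfolding norm_diff_unit[OF uM uX] by simp
  moreover have "E\<^sup>2 \<le> 1\<^sup>2" using E by (intro power_mono) auto
  ultimately have "(1 - E\<^sup>2 / 8)\<^sup>2 \<le> (M a s \<bullet> X (a + 1) t)\<^sup>2" by (intro power_mono) auto
  moreover have "1 - E\<^sup>2 / 4 \<le> (1 - E\<^sup>2 / 8)\<^sup>2" using zero_le_power2[of "E\<^sup>2 / 8"]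
    by (simp add: power2_diff)
  moreover have "(M a s \<bullet> X (a + 1) t)\<^sup>2 = (m a s \<bullet> \<xi> (a + 1) t)\<^sup>2"
    using \<zeta>[of a s] \<epsilon>[of "a + 1" t] by (auto simp: M_def X_def)
  ultimately show ?thesis by linarith
qed


section \<open>Continuity of the alignment\<close>

definition line_rep :: "(real^3) set \<Rightarrow> (real^3) \<times> (real^3)" where
  "line_rep L = (SOME p. p \<in> unit_tangents \<and> L = line (fst p) (snd p))"

definition direction :: "(real^3) set \<Rightarrow> real^3" where
  "direction L = snd (line_rep L)"

text \<open>Direction and moment of a line are defined only up to a common sign; quadratic expressions in
  either of them are well defined.\<close>

definition moment :: "(real^3) set \<Rightarrow> real^3" where
  "moment L = cross3 (fst (line_rep L)) (snd (line_rep L))"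

text \<open>Lines tangent to the unit sphere have unit moments, so this is the squared cosine of an angle. It
  equals \<open>1\<close> for all pairs of consecutive lines of the octahedral configuration, and it is invariant
  under rotations; closeness to that configuration up to rotation is expressed through it.\<close>

definition alignment :: "(real^3) set \<Rightarrow> (real^3) set \<Rightarrow> real" where
  "alignment L L' = (moment L \<bullet> direction L')\<^sup>2"

lemma line_rep_cases:
  assumes "(x, \<xi>) \<in> unit_tangents"
  obtains "direction (line x \<xi>) = \<xi>" "moment (line x \<xi>) = cross3 x \<xi>"
    | "direction (line x \<xi>) = - \<xi>" "moment (line x \<xi>) = - cross3 x \<xi>"
proof -
  have "line_rep (line x \<xi>) \<in> unit_tangents \<and> line x \<xi> = line (fst (line_rep (line x \<xi>))) (snd (line_rep (line x \<xi>)))"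
    unfolding line_rep_def by (rule someI[of _ "(x, \<xi>)"]) (use assms in simp)
  then obtain y \<eta> where r: "line_rep (line x \<xi>) = (y, \<eta>)" "(y, \<eta>) \<in> unit_tangents" "line x \<xi> = line y \<eta>"
    by (metis prod.collapse)
  then have "x = y \<and> (\<xi> = \<eta> \<or> \<xi> = - \<eta>)" using line_eq_iff_unit_tangents[OF assms r(2)] by blast
  then show thesis using that r(1) by (auto simp: direction_def moment_def)
qed

lemma alignment_line:
  assumes "(x, \<xi>) \<in> unit_tangents" "(y, \<eta>) \<in> unit_tangents"
  shows "alignment (line x \<xi>) (line y \<eta>) = (cross3 x \<xi> \<bullet> \<eta>)\<^sup>2"
  by (cases rule: line_rep_cases[OF assms(1)]; cases rule: line_rep_cases[OF assms(2)])
    (simp_all add: alignment_def)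

text \<open>A product of two coordinates of the direction does not change under \<open>\<xi> \<mapsto> - \<xi>\<close>, so it descends
  from the unit tangent bundle to the quotient.\<close>

lemma continuous_map_direction: "continuous_map tangent_line_topology euclideanreal (\<lambda>L. direction L $ k * direction L $ l)"
proof (rule continuous_compose_quotient_map[OF quotient_map_tangent_lines])
  have "continuous_map (top_of_set unit_tangents) euclideanreal (\<lambda>p. snd p $ k * snd p $ l)"
    by (auto intro!: continuous_intros)
  then show "continuous_map (top_of_set unit_tangents) euclideanreal ((\<lambda>L. direction L $ k * direction L $ l) \<circ> (\<lambda>(x, \<xi>). line x \<xi>))"
  proof (rule continuous_map_eq)
    fix p assume "p \<in> topspace (top_of_set unit_tangents)"
    then obtain x \<xi> where p: "p = (x, \<xi>)" "(x, \<xi>) \<in> unit_tangents" by (cases p) auto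
    show "snd p $ k * snd p $ l = ((\<lambda>L. direction L $ k * direction L $ l) \<circ> (\<lambda>(x, \<xi>). line x \<xi>)) p"
      by (cases rule: line_rep_cases[OF p(2)]) (simp_all add: p(1))
  qed
qed

lemma continuous_map_moment: "continuous_map tangent_line_topology euclideanreal (\<lambda>L. moment L $ k * moment L $ l)"
proof (rule continuous_compose_quotient_map[OF quotient_map_tangent_lines])
  have "continuous_map (top_of_set unit_tangents) euclideanreal (\<lambda>p. cross3 (fst p) (snd p) $ k * cross3 (fst p) (snd p) $ l)"
    by (auto intro!: continuous_intros continuous_on_cross)
  then show "continuous_map (top_of_set unit_tangents) euclideanreal ((\<lambda>L. moment L $ k * moment L $ l) \<circ> (\<lambda>(x, \<xi>). line x \<xi>))"
  proof (rule continuous_map_eq)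
    fix p assume "p \<in> topspace (top_of_set unit_tangents)"
    then obtain x \<xi> where p: "p = (x, \<xi>)" "(x, \<xi>) \<in> unit_tangents" by (cases p) auto
    show "cross3 (fst p) (snd p) $ k * cross3 (fst p) (snd p) $ l = ((\<lambda>L. moment L $ k * moment L $ l) \<circ> (\<lambda>(x, \<xi>). line x \<xi>)) p"
      by (cases rule: line_rep_cases[OF p(2)]) (simp_all add: p(1))
  qed
qed

text \<open>A product of quotient maps is in general not a quotient map. Splitting the alignment into terms
  that each depend on one line avoids this question.\<close>

lemma alignment_sum:
  "alignment L L' = (\<Sum>k\<in>UNIV. \<Sum>l\<in>UNIV. (moment L $ k * moment L $ l) * (direction L' $ k * direction L' $ l))"
  unfolding alignment_def power2_eq_square inner_vec_def sum_product by (simp add: ac_simps)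

lemma continuous_map_alignment:
  assumes "i \<in> {1..6}" "j \<in> {1..6}"
  shows "continuous_map configuration_space euclideanreal (\<lambda>c. alignment (tangent_generator (c i)) (tangent_generator (c j)))"
proof -
  let ?f = "\<lambda>c. \<lambda>i\<in>{1..6}. tangent_generator (c i)"
  have f: "continuous_map configuration_space (product_topology (\<lambda>_. tangent_line_topology) {1..6::nat}) ?f"
    using homeomorphic_imp_continuous_map[OF homeomorphic_map_configuration_space]
    by (rule continuous_map_into_fulltopology)
  have g: "continuous_map configuration_space tangent_line_topology (\<lambda>c. tangent_generator (c i))" if i: "i \<in> {1..6}" for i
    using continuous_map_compose[OF f continuous_map_product_projection[OF i]] i by (simp add: o_def)
  note m = continuous_map_compose[OF g[OF assms(1)] continuous_map_moment, unfolded o_def]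
  note d = continuous_map_compose[OF g[OF assms(2)] continuous_map_direction, unfolded o_def]
  show ?thesis unfolding alignment_sum
    by (intro continuous_map_sum continuous_map_real_mult m d) simp_all
qed

section \<open>The octahedral configuration and its neighbourhood\<close>

definition label :: "3 \<times> bool \<Rightarrow> nat" where
  "label p = (if fst p = 1 then 1 else if fst p = 2 then 3 else 5) + (if snd p then 0 else 1)"

lemma bij_betw_label: "bij_betw label UNIV {1..6}"
proof (rule bij_betw_imageI)
  show inj: "inj label"
  proof (rule inj_on_inverseI)
    fix p :: "3 \<times> bool"
    obtain a s where p: "p = (a, s)" by (cases p)
    show "(\<lambda>n. (if n \<le> 2 then 1 else if n \<le> 4 then 2 else 3, odd n)) (label p) = p"
      unfolding p using exhaust_3[of a] by (elim disjE; simp add: label_def)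
  qed
  have "range label \<subseteq> {1..6}" by (auto simp: label_def)
  moreover have "card (range label) = card {1..6::nat}"
    unfolding card_image[OF inj] by simp
  ultimately show "range label = {1..6}" by (intro card_subset_eq) auto
qed

lemma label_range: "label p \<in> {1..6}"
  using bij_betw_apply[OF bij_betw_label] by simp

lemma labelled_configuration:
  assumes tangent: "\<And>p. (fst (l p), snd (l p)) \<in> unit_tangents"
    and sep: "\<And>p q. p \<noteq> q \<Longrightarrow> 1 \<le> setdist (line (fst (l p)) (snd (l p))) (line (fst (l q)) (snd (l q)))"
  shows "\<exists>c\<in>configurations. \<forall>p. tangent_generator (c (label p)) = line (fst (l p)) (snd (l p))"
proof -
  define C where "C p = solid_cylinder 1 (line (2 *\<^sub>R fst (l p)) (snd (l p)))" for p
  have C: "C p \<in> touching_cylinders" for p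
    unfolding touching_cylinders_eq C_def using tangent[of p] by force
  have gen: "tangent_generator (C p) = line (fst (l p)) (snd (l p))" for p
    unfolding C_def by (rule tangent_generator_solid_cylinder[OF tangent])
  have disj: "interior (C p) \<inter> interior (C q) = {}" if "p \<noteq> q" for p q
    unfolding interior_disjoint_iff_setdist[OF C C] gen using sep[OF that] .
  define u where "u = inv_into UNIV label"
  have u: "u (label p) = p" for p
    unfolding u_def by (rule bij_betw_inv_into_left[OF bij_betw_label]) simp
  have ul: "label (u i) = i" if "i \<in> {1..6}" for i
    unfolding u_def by (rule bij_betw_inv_into_right[OF bij_betw_label that])
  show ?thesis
  proof (intro bexI allI)
    show "(\<lambda>i\<in>{1..6}. C (u i)) \<in> configurations"
    proof -
      have "interior (C (u i)) \<inter> interior (C (u j)) = {}" if "i \<in> {1..6}" "j \<in> {1..6}" "i \<noteq> j" for i j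
        using ul[OF that(1)] ul[OF that(2)] that(3) by (intro disj) metis
      then show ?thesis unfolding configurations_def using C by simp
    qed
    show "tangent_generator ((\<lambda>i\<in>{1..6}. C (u i)) (label p)) = line (fst (l p)) (snd (l p))" for p
      using label_range[of p] by (simp only: restrict_apply' u gen)
  qed
qed

text \<open>Two parallel planes containing the two lines bound their distance from below.\<close>

lemma setdist_lines_ge:
  assumes "norm n = 1" "n \<bullet> \<xi> = 0" "n \<bullet> \<eta> = 0" "1 \<le> \<bar>n \<bullet> (x - y)\<bar>"
  shows "1 \<le> setdist (line x \<xi>) (line y \<eta>)"
proof (rule le_setdistI)
  fix p q assume "p \<in> line x \<xi>" "q \<in> line y \<eta>"
  then have "n \<bullet> (p - q) = n \<bullet> (x - y)" using assms by (auto simp: line_def inner_simps)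
  then show "1 \<le> dist p q" using assms Cauchy_Schwarz_ineq2[of n "p - q"] by (simp add: dist_norm)
qed simp_all

definition octahedral :: "3 \<times> bool \<Rightarrow> (real^3) \<times> (real^3)" where
  "octahedral p = (sg (snd p) *\<^sub>R axis (fst p) 1, axis (fst p + 1) 1)"

lemma three_distinct: fixes a :: 3 shows "a + 1 \<noteq> a" "a + 2 \<noteq> a" "a + 2 \<noteq> a + 1"
  "a \<noteq> a + 1" "a \<noteq> a + 2" "a + 1 \<noteq> a + 2"
  using exhaust_3[of a] by auto

lemma octahedral_tangent: "(fst (octahedral p), snd (octahedral p)) \<in> unit_tangents"
  by (simp add: octahedral_def unit_tangents_def sg_def inner_axis_axis three_distinct)

text \<open>The separating planes are orthogonal to \<open>axis a 1\<close>: the line with index \<open>a\<close> lies in one at height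
  \<open>1\<close> or \<open>-1\<close>, the line with index \<open>a + 1\<close> in the one through the origin.\<close>

lemma octahedral_sep:
  assumes "p \<noteq> q"
  shows "1 \<le> setdist (line (fst (octahedral p)) (snd (octahedral p))) (line (fst (octahedral q)) (snd (octahedral q)))"
proof -
  obtain a s b t where pq: "p = (a, s)" "q = (b, t)" by (cases p; cases q) auto
  have "b = a \<or> b = a + 1 \<or> a = b + 1" using exhaust_3[of a] exhaust_3[of b] by auto
  then show ?thesis
  proof (elim disjE)
    assume "b = a"
    then show ?thesis unfolding octahedral_def pq fst_conv snd_conv using assms pq
      by (intro setdist_lines_ge[where n = "axis a 1"])
        (auto simp: inner_axis_axis inner_simps three_distinct sg_def)
  next
    assume "b = a + 1"
    then show ?thesis unfolding octahedral_def pq fst_conv snd_conv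
      by (intro setdist_lines_ge[where n = "axis a 1"])
        (auto simp: inner_axis_axis inner_simps three_distinct sg_def cyclic_add_3)
  next
    assume "a = b + 1"
    then show ?thesis unfolding octahedral_def pq fst_conv snd_conv
      by (intro setdist_lines_ge[where n = "axis b 1"])
        (auto simp: inner_axis_axis inner_simps three_distinct sg_def cyclic_add_3)
  qed
qed

lemma cross_octahedral:
  "cross3 (fst (octahedral (a, s))) (snd (octahedral (a, s))) = sg s *\<^sub>R axis (a + 2) 1"
proof -
  have "(4::3) = 1" "(5::3) = 2" by simp_all
  note wrap = this
  show ?thesis
    using exhaust_3[of a] cross_basis by (auto simp: octahedral_def cross_mult_left wrap)
qed

lemma alignment_octahedral:
  "alignment (line (fst (octahedral (a, s))) (snd (octahedral (a, s))))
     (line (fst (octahedral (b, t))) (snd (octahedral (b, t)))) = (if b = a + 1 then 1 else 0)"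
  unfolding alignment_line[OF octahedral_tangent octahedral_tangent] cross_octahedral
  using exhaust_3[of a] exhaust_3[of b] by (auto simp: octahedral_def inner_axis_axis sg_def)

text \<open>The alignments of consecutive lines omit an interval of values: if all of them exceed the lower
  end, then none lies below the upper end.\<close>

lemma configuration_gap:
  assumes conf: "c \<in> configurations" and E: "0 < E" "E \<le> 1/100000"
    and near: "\<And>a s t. 1 - E\<^sup>2 / 2
      < alignment (tangent_generator (c (label (a, s)))) (tangent_generator (c (label (a + 1, t))))"
  shows "1 - E\<^sup>2 / 4
    \<le> alignment (tangent_generator (c (label (a, s)))) (tangent_generator (c (label (a + 1, t))))"
proof -
  have touch: "c (label p) \<in> touching_cylinders" for p
    using conf label_range[of p] by (auto simp: configurations_def)
  have "\<exists>y \<eta>. (y, \<eta>) \<in> unit_tangents \<and> tangent_generator (c (label (a, s))) = line y \<eta>" for a s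
    using bij_betw_apply[OF bij_betw_tangent_generator touch[of "(a, s)"]]
    unfolding tangent_lines_def by (elim imageE) auto
  then obtain x \<xi> where tangent: "\<And>a s. (x a s, \<xi> a s) \<in> unit_tangents"
    and gen: "\<And>a s. tangent_generator (c (label (a, s))) = line (x a s) (\<xi> a s)" by metis
  have "1 \<le> setdist (line (x a s) (\<xi> a s)) (line (x b t) (\<xi> b t))" if "(a, s) \<noteq> (b, t)" for a s b t
  proof -
    have "label (a, s) \<noteq> label (b, t)" using that bij_betw_imp_inj_on[OF bij_betw_label] by (auto dest: injD)
    then have "interior (c (label (a, s))) \<inter> interior (c (label (b, t))) = {}"
      using conf label_range by (auto simp: configurations_def)
    then show ?thesis unfolding interior_disjoint_iff_setdist[OF touch touch] gen .
  qed
  moreover have "1 - E\<^sup>2 / 2 < (cross3 (x a s) (\<xi> a s) \<bullet> \<xi> (a + 1) t)\<^sup>2" for a s t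
    using near[of a s t] by (simp add: gen alignment_line[OF tangent tangent])
  ultimately show ?thesis unfolding gen alignment_line[OF tangent tangent]
    by (intro octahedral_gap[OF tangent _ E]) 
qed

theorem corollary3:
  shows "\<not> connected_space configuration_space"
proof
  assume conn: "connected_space configuration_space"
  define E :: real where "E = 1/100000"
  define f where "f = (\<lambda>(a, s, t) c. alignment (tangent_generator (c (label (a, s)))) (tangent_generator (c (label (a + 1, t)))))"
  have cont: "continuous_map configuration_space euclideanreal (f i)" for i
    unfolding f_def by (cases i) (auto intro: continuous_map_alignment label_range simp del: atLeastAtMost_iff)
  \<comment> \<open>By the gap between \<open>1 - E\<^sup>2 / 2\<close> and \<open>1 - E\<^sup>2 / 4\<close> these open sets are disjoint and cover
    everything.\<close>
  define U where "U = (\<Inter>i. {c \<in> topspace configuration_space. f i c \<in> {1 - E\<^sup>2 / 2 <..}})"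
  define V where "V = (\<Union>i. {c \<in> topspace configuration_space. f i c \<in> {..< 1 - E\<^sup>2 / 4}})"
  have "openin configuration_space U"
    unfolding U_def by (rule openin_INT2) (simp_all only: finite UNIV_not_empty
      openin_continuous_map_preimage[OF cont] open_openin[symmetric] open_greaterThan, simp)
  moreover have "openin configuration_space V"
    unfolding V_def
    by (intro openin_Union) (use openin_continuous_map_preimage[OF cont open_openin[THEN iffD1, OF open_lessThan]] in blast)
  moreover have "topspace configuration_space \<subseteq> U \<union> V"
  proof
    fix c assume c: "c \<in> topspace configuration_space"
    show "c \<in> U \<union> V"
    proof (cases "\<forall>i. 1 - E\<^sup>2 / 2 < f i c")
      case False
      then obtain i where "f i c \<le> 1 - E\<^sup>2 / 2" using not_less by blast
      also have "\<dots> < 1 - E\<^sup>2 / 4" by (simp add: E_def)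
      finally show ?thesis using c unfolding V_def by blast
    qed (use c in \<open>unfold U_def, blast\<close>)
  qed
  moreover have "U \<inter> V = {}"
  proof -
    have "1 - E\<^sup>2 / 4 \<le> f i c" if "c \<in> U" for c i
    proof -
      obtain a s t where i: "i = (a, s, t)" by (cases i) auto
      have "c \<in> {c \<in> topspace configuration_space. f j c \<in> {1 - E\<^sup>2 / 2 <..}}" for j
        using that unfolding U_def by blast
      then have "c \<in> configurations" and "1 - E\<^sup>2 / 2 < f j c" for j by simp_all
      from this(1) this(2)[of "(_, _, _)"] show ?thesis
        unfolding i f_def prod.case by (intro configuration_gap) (simp_all add: E_def)
    qed
    then show ?thesis unfolding V_def by (auto simp flip: not_le)
  qed
  moreover have "U \<noteq> {}"
  proof -
    obtain c where "c \<in> configurations" and gen: "\<And>p. tangent_generator (c (label p)) = line (fst (octahedral p)) (snd (octahedral p))"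
      using labelled_configuration[of octahedral, OF octahedral_tangent octahedral_sep] by blast
    moreover have "f i c = 1" for i by (cases i) (simp add: f_def gen alignment_octahedral)
    ultimately have "c \<in> U" by (simp add: U_def E_def)
    then show ?thesis by blast
  qed
  moreover have "V \<noteq> {}"
  proof -
    \<comment> \<open>Exchanging the indices \<open>1\<close> and \<open>2\<close> reverses the cyclic order of the axes, so that the moment
      of each line becomes orthogonal to the directions of the lines with the next index.\<close>
    define relabel :: "3 \<times> bool \<Rightarrow> 3 \<times> bool" where "relabel p = (- fst p, snd p)" for p
    have inj: "relabel p \<noteq> relabel q" if "p \<noteq> q" for p q using that by (simp add: relabel_def prod_eq_iff)
    obtain c where "c \<in> configurations" and gen: "\<And>p. tangent_generator (c (label p)) = line (fst (octahedral (relabel p))) (snd (octahedral (relabel p)))"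
      using labelled_configuration[of "\<lambda>p. octahedral (relabel p)", OF octahedral_tangent octahedral_sep[OF inj]] by blast
    moreover have "f (3, True, True) c = 0" by (simp add: f_def gen relabel_def alignment_octahedral)
    ultimately have "c \<in> {c \<in> topspace configuration_space. f (3, True, True) c \<in> {..< 1 - E\<^sup>2 / 4}}"
      by (simp add: E_def power_divide)
    then have "c \<in> V" unfolding V_def by blast
    then show ?thesis by blast
  qed
  ultimately show False by (rule connected_spaceD[OF conn])
qed

end
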